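(* Consider the leader $\dot v=\phi(v)\omega$, $q_{N+1}=Ev$, and, for $i=1,\dots,N$, the learning-based distributed observer $$\dot{\hat v}_i=\phi(\hat v_i)\hat\omega_i+\hat\kappa_i\rho_i(z_i)z_i,\quad \dot{\hat\omega}_i=\mu\,\phi^T(\hat v_i)z_i,\quad \dot{\hat\kappa}_i=\rho_i(z_i)z_i^Tz_i,\quad z_i=\sum_{j\in\bar{\mathcal N}_i}(\hat v_j-\hat v_i),$$ with $\hat v_{N+1}=v$, where $\hat v_i\in\mathbb{R}^m$, $\hat\omega_i\in\mathbb{R}^l$, $\hat\kappa_i\in\mathbb{R}$. Then there exist smooth functions $\rho_i:\mathbb{R}^m\to\mathbb{R}$ with $\rho_i\ge1$, $i=1,\dots,N$, such that for every $\mu>0$, every $v(0)\in\mathbb{V}_0$, every $\hat v_i(0)\in\mathbb{V}_0$, every $\hat\omega_i(0)\in\mathbb{R}^l$ and every $\hat\kappa_i(0)\in\mathbb{R}$, the signals $\hat v_i(t),\hat\kappa_i(t),\hat\omega_i(t)$ exist and are bounded on $[0,\infty)$ and, with $\tilde v_i=\hat v_i-v$ and $\tilde\omega_i=\hat\omega_i-\omega$, $$\lim_{t\to\infty}\tilde v_i(t)=0,\qquad \lim_{t\to\infty}\dot{\tilde\omega}_i(t)=0,\qquad \lim_{t\to\infty}\phi(\hat v_i(t))\tilde\omega_i(t)=0,\qquad i=1,\dots,N.$$ Moreover, if $t\mapsto\phi^T(v(t))$ is persistently exciting, then $\lim_{t\to\infty}\tilde\omega_i(t)=0$ for $i=1,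\dots,N$.
   Context: Leader: $v\in\mathbb{R}^m$, $\phi:\mathbb{R}^m\to\mathbb{R}^{m\times l}$ a known smooth function, $\omega\in\mathbb{R}^l$ an unknown constant vector, $E\in\mathbb{R}^{n\times m}$ known; standing assumption: for every compact $\mathbb{V}_0\subset\mathbb{R}^m$ containing the origin there is a compact $\mathbb{V}$ such that every solution with $v(0)\in\mathbb{V}_0$ satisfies $v(t)\in\mathbb{V}$ for all $t\ge0$. Communication graph: $\bar{\mathcal G}=(\bar{\mathcal V},\bar{\mathcal E})$ with $\bar{\mathcal V}=\{1,\dots,N,N+1\}$, node $N+1$ the leader; for $i\in\bar{\mathcal V}$, $j\in\{1,\dots,N\}$, $(i,j)\in\bar{\mathcal E}$ iff node $j$ receives information from node $i$; $\bar{\mathcal N}_i=\{j:(j,i)\in\bar{\mathcal E}\}$. It is assumed that $\bar{\mathcal G}$ contains a spanning tree rooted at node $N+1$ and that the subgraph induced on the followers $\{1,\dots,N\}$ is undirected. Persistent excitation: a bounded piecewise continuous $f:[0,\infty)\to\mathbb{R}^{n\times m}$ is persistently exciting if there exist $\epsilon,t_0,T_0>0$ with $\frac1{T_0}\int_t^{t+T_0}f(s)f^T(s)\,ds\ge\epsilon I_n$ for all $t\ge t_0$. *)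

theory Defs
  imports "HOL-Analysis.Analysis"
begin

text \<open>C-infinity smoothness on the whole space: f is differentiable everywhere and every
  directional derivative x maps to f'(x) b is again smooth (greatest fixed point, so all
  iterated derivatives exist).\<close>
coinductive smooth_fun :: "('a::real_normed_vector \<Rightarrow> 'b::real_normed_vector) \<Rightarrow> bool" where
  "(\<forall>x. f differentiable (at x)) \<Longrightarrow>
   (\<forall>b. smooth_fun (\<lambda>x. frechet_derivative f (at x) b)) \<Longrightarrow> smooth_fun f"

definition leader_solution ::
  "(real^'m \<Rightarrow> real^'l^'m) \<Rightarrow> real^'l \<Rightarrow> (real \<Rightarrow> real^'m) \<Rightarrow> bool" where
  "leader_solution phi \<omega> v \<longleftrightarrow>
     (\<forall>t\<ge>0. (v has_vector_derivative (phi (v t) *v \<omega>)) (at t within {0..}))"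

definition nbrs :: "(nat \<times> nat) set \<Rightarrow> nat \<Rightarrow> nat set" where
  "nbrs Eg i = {j. (j, i) \<in> Eg}"

definition obs_z ::
  "nat \<Rightarrow> (nat \<times> nat) set \<Rightarrow> (real \<Rightarrow> real^'m) \<Rightarrow> (nat \<Rightarrow> real \<Rightarrow> real^'m)
     \<Rightarrow> nat \<Rightarrow> real \<Rightarrow> real^'m" where
  "obs_z N Eg v vh i t =
     (\<Sum>j\<in>nbrs Eg i. (if j = N + 1 then v t else vh j t) - (if i = N + 1 then v t else vh i t))"

definition observer_solution ::
  "(real^'m \<Rightarrow> real^'l^'m) \<Rightarrow> nat \<Rightarrow> (nat \<times> nat) set \<Rightarrow> real \<Rightarrow> (nat \<Rightarrow> real^'m \<Rightarrow> real)
    \<Rightarrow> (real \<Rightarrow> real^'m) \<Rightarrow> (nat \<Rightarrow> real \<Rightarrow> real^'m) \<Rightarrow> (nat \<Rightarrow> real \<Rightarrow> real^'l)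
    \<Rightarrow> (nat \<Rightarrow> real \<Rightarrow> real) \<Rightarrow> bool" where
  "observer_solution phi N Eg \<mu> \<rho> v vh wh kh \<longleftrightarrow>
     (\<forall>i\<in>{1..N}. \<forall>t\<ge>0.
        (vh i has_vector_derivative
           (phi (vh i t) *v wh i t + (kh i t * \<rho> i (obs_z N Eg v vh i t)) *\<^sub>R obs_z N Eg v vh i t))
           (at t within {0..}) \<and>
        (wh i has_vector_derivative
           (\<mu> *\<^sub>R (transpose (phi (vh i t)) *v obs_z N Eg v vh i t))) (at t within {0..}) \<and>
        (kh i has_real_derivative
           (\<rho> i (obs_z N Eg v vh i t) * (obs_z N Eg v vh i t \<bullet> obs_z N Eg v vh i t)))
           (at t within {0..}))"

definition piecewise_continuous_nonneg :: "(real \<Rightarrow> 'a::topological_space) \<Rightarrow> bool" where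
  "piecewise_continuous_nonneg f \<longleftrightarrow>
     (\<forall>b\<ge>0. \<exists>S. finite S \<and> S \<subseteq> {0..b} \<and>
        (\<forall>t\<in>{0..b} - S. continuous (at t within {0..}) f) \<and>
        (\<forall>s\<in>S. (0 < s \<longrightarrow> (\<exists>L. (f \<longlongrightarrow> L) (at_left s))) \<and> (\<exists>R. (f \<longlongrightarrow> R) (at_right s))))"

text \<open>Persistent excitation of f : [0,infinity) to R^(n x m); the matrix inequality
  (1/T0) int_t^(t+T0) f f^T ds \<ge> eps I is the Loewner order, i.e. in quadratic forms.\<close>
definition persistently_exciting :: "(real \<Rightarrow> real^'m^'n) \<Rightarrow> bool" where
  "persistently_exciting f \<longleftrightarrow>
     bounded (f ` {0..}) \<and> piecewise_continuous_nonneg f \<and>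
     (\<exists>\<epsilon> t0 T0. \<epsilon> > 0 \<and> t0 > 0 \<and> T0 > 0 \<and>
        (\<forall>t\<ge>t0. \<forall>x::real^'n.
           (1 / T0) * (x \<bullet> (integral {t..t + T0} (\<lambda>s. f s ** transpose (f s)) *v x)) \<ge> \<epsilon> * (x \<bullet> x)))"

end

theory Submission
  imports Defs "HOL-Probability.Discrete_Topology"
begin

text \<open>Write \<open>e\<^sub>i\<close> for the estimation error of follower \<open>i\<close>. Then \<open>z = - H e\<close> with \<open>H\<close> the grounded
  Laplacian, which is symmetric because the followers are undirected and positive definite because
  the leader reaches everyone. Along solutions,
  \<open>V = e\<^sup>T H e / 2 + \<Sum>|w\<^sub>i - \<omega>|\<^sup>2 / (2 \<mu>) + \<Sum>(k\<^sub>i - \<kappa>)\<^sup>2 / 2\<close> has derivative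
  \<open>- \<Sum> z\<^sub>i \<bullet> (\<phi>(v\<^sub>i) - \<phi>(v)) \<omega> - \<kappa> \<Sum> \<rho>(z\<^sub>i) |z\<^sub>i|\<^sup>2\<close>. As \<open>v\<close> stays in a compact set and \<open>e\<close> is bounded
  linearly by the largest \<open>z\<^sub>j\<close>, a smooth \<open>\<rho>\<close> dominating the squares of the local Lipschitz constants
  of \<open>\<phi>\<close> and a large constant \<open>\<kappa>\<close> make this nonpositive; \<open>\<rho>\<close> is an entire power series in \<open>|z|\<^sup>2\<close>.
  Hence all signals are bounded and exist for all time. The gains \<open>k\<^sub>i\<close> are nondecreasing and bounded,
  hence convergent, and a Barbalat argument gives \<open>z \<longlongrightarrow> 0\<close>, thus \<open>e \<longlongrightarrow> 0\<close>; a second one, applied to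
  \<open>e\<close>, gives \<open>\<phi>(v\<^sub>i) (w\<^sub>i - \<omega>) \<longlongrightarrow> 0\<close>, from which persistent excitation yields \<open>w\<^sub>i \<longlongrightarrow> \<omega>\<close>.\<close>

section \<open>Smooth functions\<close>

text \<open>The obstacle: \<rho> sees only a follower's own \<open>z\<close> and is fixed before
  \<mu>, the trajectories and the initial gains, while the Lipschitz constant of \<open>phi\<close>
  that matters at follower i depends on how far that follower is from the leader. Positive
  definiteness of H yields a single index j whose z_j controls all errors at once, so every mismatch
  is charged to the one term \<rho>(z_j) |z_j|^2, which the sum over followers contains anyway; the
  same \<rho> therefore serves every follower. The number \<kappa> is a virtual gain that lives only
  in V: the adaptive k_i takes its place in the observer, and the weight 1/(2 \<mu>) removes \<mu>
  from the derivative of V. So \<rho> and \<kappa> depend only on the graph, \<open>phi\<close>,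
  \<omega> and the bound for the leader.\<close>

lemma smooth_fun_differentiable: "smooth_fun f \<Longrightarrow> f differentiable (at x)"
  by (erule smooth_fun.cases) blast

lemma smooth_fun_continuous_on: "smooth_fun f \<Longrightarrow> continuous_on S f"
  by (meson smooth_fun_differentiable continuous_at_imp_continuous_on
      differentiable_imp_continuous_within)

lemma smooth_fun_frechet_derivative:
  "smooth_fun f \<Longrightarrow> smooth_fun (\<lambda>x. frechet_derivative f (at x) b)"
  by (erule smooth_fun.cases) blast

text \<open>The coinductive notion speaks of one direction at a time, so the operator norm of the
  derivative is bounded through its values on the finitely many basis vectors, each continuous on
  the compact ball; the mean value inequality does the rest.\<close>

lemma smooth_fun_lipschitz_on_cball:
  fixes f :: "'a::euclidean_space \<Rightarrow> 'b::real_normed_vector"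
  assumes "smooth_fun f"
  obtains L where "L \<ge> 0"
    "\<And>x y. norm x \<le> r \<Longrightarrow> norm y \<le> r \<Longrightarrow> norm (f x - f y) \<le> L * norm (x - y)"
proof -
  define D where "D x = frechet_derivative f (at x)" for x
  have D: "(f has_derivative D x) (at x)" for x
    unfolding D_def using smooth_fun_differentiable[OF assms] frechet_derivative_works by blast
  have "\<exists>M. \<forall>x\<in>cball 0 r. norm (D x b) \<le> M" for b
  proof -
    have "continuous_on (cball 0 r) (\<lambda>x. D x b)"
      unfolding D_def by (intro smooth_fun_continuous_on smooth_fun_frechet_derivative assms)
    then have "bounded ((\<lambda>x. D x b) ` cball 0 r)"
      by (simp add: compact_continuous_image compact_imp_bounded)
    then show ?thesis unfolding bounded_iff by auto
  qed
  then obtain M where M: "norm (D x b) \<le> M b" if "x \<in> cball 0 r" for x b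
    by metis
  define L where "L = (\<Sum>b\<in>Basis. \<bar>M b\<bar>)"
  have "onorm (D x) \<le> L" if x: "x \<in> cball 0 r" for x
  proof (rule onorm_le)
    fix h
    have lin: "linear (D x)" using D has_derivative_linear by blast
    have "D x h = D x (\<Sum>b\<in>Basis. (h \<bullet> b) *\<^sub>R b)" by (simp add: euclidean_representation)
    also have "\<dots> = (\<Sum>b\<in>Basis. (h \<bullet> b) *\<^sub>R D x b)"
      by (simp add: linear_sum[OF lin] linear_scale[OF lin])
    also have "norm \<dots> \<le> (\<Sum>b\<in>Basis. norm h * \<bar>M b\<bar>)"
    proof (rule sum_norm_le)
      fix b :: 'a assume b: "b \<in> Basis"
      have "norm (D x b) \<le> \<bar>M b\<bar>" using M[OF x, of b] by linarith
      then show "norm ((h \<bullet> b) *\<^sub>R D x b) \<le> norm h * \<bar>M b\<bar>"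
        using Basis_le_norm[OF b, of h] by (simp add: mult_mono)
    qed
    finally show "norm (D x h) \<le> L * norm h"
      by (simp add: L_def sum_distrib_left mult.commute)
  qed
  then have "norm (f x - f y) \<le> L * norm (x - y)" if "norm x \<le> r" "norm y \<le> r" for x y
    using that D by (intro differentiable_bound[of "cball 0 r" f D])
      (auto intro: has_derivative_at_withinI)
  moreover have "L \<ge> 0" unfolding L_def by (simp add: sum_nonneg)
  ultimately show thesis using that by blast
qed

text \<open>An entire series with nonnegative coefficients at sparse exponents can outgrow any
  sequence, and each single term bounds the sum from below when \<open>s\<close> is
  nonnegative.\<close>

lemma ex_entire_series_majorant:
  fixes L :: "nat \<Rightarrow> real"
  obtains c :: "nat \<Rightarrow> real" where "\<And>m. c m \<ge> 0" "\<And>s. summable (\<lambda>m. c m * s ^ m)"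
    "\<And>n s. real n \<le> s \<Longrightarrow> s \<le> real n + 1 \<Longrightarrow> L n \<le> (\<Sum>m. c m * s ^ m)"
proof -
  \<comment> \<open>The term \<open>(2 s / n) ^ K n\<close> alone is at least \<open>2 ^ K n\<close>, hence at least \<open>L n\<close>, on \<open>[n, n + 1]\<close>.\<close>
  define K where "K n = n + (\<Sum>k\<le>n. nat \<lceil>\<bar>L k\<bar>\<rceil>)" for n
  have K_mono: "strict_mono K"
    unfolding strict_mono_Suc_iff K_def by (simp add: less_Suc_eq_le)
  have K_ge: "L n \<le> 2 ^ K n" for n
  proof -
    have "nat \<lceil>\<bar>L n\<bar>\<rceil> \<le> (\<Sum>k\<le>n. nat \<lceil>\<bar>L k\<bar>\<rceil>)"
      by (rule member_le_sum) auto
    then have "nat \<lceil>\<bar>L n\<bar>\<rceil> \<le> K n" by (simp add: K_def)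
    then have "L n \<le> real (K n)" by linarith
    also have "\<dots> \<le> 2 ^ K n" by (rule less_imp_le) (rule of_nat_less_two_power)
    finally show ?thesis .
  qed
  \<comment> \<open>The slot \<open>m = 0\<close> serves n = 0, where the quotient 2 / n is useless;
    \<open>K n \<ge> n\<close> keeps the exponents of all n \<ge> 1 away from it.\<close>
  define c where "c m = (if m = 0 then \<bar>L 0\<bar> else if m \<in> K ` {1..} then (2 / real (inv K m)) ^ m else 0)"
    for m
  have inv_K: "inv K (K n) = n" for n
    using K_mono by (simp add: strict_mono_imp_inj_on)
  have c_K: "c (K n) = (2 / real n) ^ K n" if "n \<ge> 1" for n
  proof -
    have "K n \<noteq> 0" using that by (simp add: K_def)
    then show ?thesis using that by (auto simp: c_def inv_K)
  qed
  have c_nonneg: "c m \<ge> 0" for m by (simp add: c_def)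
  have summ: "summable (\<lambda>m. c m * s ^ m)" for s
  proof (rule summable_comparison_test_ev)
    define n0 where "n0 = nat \<lceil>4 * \<bar>s\<bar>\<rceil>"
    show "\<forall>\<^sub>F m in sequentially. norm (c m * s ^ m) \<le> (1/2) ^ m"
      unfolding eventually_sequentially
    proof (intro exI allI impI)
      fix m assume m: "K n0 + 1 \<le> m"
      show "norm (c m * s ^ m) \<le> (1/2) ^ m"
      proof (cases "m \<in> K ` {1..}")
        case True
        then obtain n where n: "n \<ge> 1" "m = K n" by auto
        then have "K n0 < K n" using m by simp
        then have "n0 < n" using K_mono by (simp add: strict_mono_less)
        then have "4 * \<bar>s\<bar> \<le> real n" unfolding n0_def by linarith
        then have "2 / real n * \<bar>s\<bar> \<le> 1/2" using n by (simp add: field_simps)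
        then have "(2 / real n * \<bar>s\<bar>) ^ m \<le> (1/2) ^ m" by (intro power_mono) auto
        then have "(2 / real n) ^ m * \<bar>s\<bar> ^ m \<le> (1/2) ^ m" by (simp only: power_mult_distrib)
        then show ?thesis using c_K[of n] n by (simp add: abs_mult power_abs)
      next
        case False
        then show ?thesis using m by (simp add: c_def)
      qed
    qed
  qed (simp add: summable_geometric)
  have "L n \<le> (\<Sum>m. c m * s ^ m)" if s: "real n \<le> s" "s \<le> real n + 1" for n s
  proof -
    have s0: "0 \<le> s" using s by linarith
    have single: "c m * s ^ m \<le> (\<Sum>m. c m * s ^ m)" for m
      using sum_le_suminf[OF summ[of s], of "{m}"] c_nonneg s0 by simp
    show ?thesis
    proof (cases "n = 0")
      case True
      then show ?thesis using single[of 0] by (simp add: c_def)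
    next
      case False
      have "L n \<le> 2 ^ K n" by (rule K_ge)
      also have "\<dots> \<le> (2 / real n * s) ^ K n"
        using False s by (intro power_mono) (auto simp: field_simps)
      also have "\<dots> = c (K n) * s ^ K n" using c_K[of n] False
        by (simp add: power_mult_distrib[symmetric])
      also have "\<dots> \<le> (\<Sum>m. c m * s ^ m)" by (rule single)
      finally show ?thesis .
    qed
  qed
  with c_nonneg summ show thesis using that by blast
qed

text \<open>A class of functions closed under directional derivatives, as needed for the coinductive
  proof of smoothness.\<close>

inductive entire_alg :: "('a::real_inner \<Rightarrow> real) \<Rightarrow> bool" where
  entire_alg_series: "(\<And>s::real. summable (\<lambda>m. c m * s ^ m)) \<Longrightarrow> entire_alg (\<lambda>x. \<Sum>m. c m * (x \<bullet> x) ^ m)"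
| entire_alg_inner: "entire_alg (\<lambda>x. x \<bullet> b)"
| entire_alg_const: "entire_alg (\<lambda>x. a)"
| entire_alg_add: "entire_alg f \<Longrightarrow> entire_alg g \<Longrightarrow> entire_alg (\<lambda>x. f x + g x)"
| entire_alg_mult: "entire_alg f \<Longrightarrow> entire_alg g \<Longrightarrow> entire_alg (\<lambda>x. f x * g x)"

text \<open>Taking the squared norm as inner variable keeps the class closed: the chain rule gives
  the termwise differentiated series times \<open>2 * (x \<bullet> h)\<close>, again a product of
  members for fixed \<open>h\<close>.\<close>

lemma entire_alg_has_derivative:
  "entire_alg f \<Longrightarrow> \<exists>f'. (\<forall>x. (f has_derivative f' x) (at x)) \<and> (\<forall>b. entire_alg (\<lambda>x. f' x b))"
proof (induction rule: entire_alg.induct)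
  case (entire_alg_series c)
  have F: "((\<lambda>s. \<Sum>m. c m * s ^ m) has_derivative (\<lambda>h. (\<Sum>m. diffs c m * s ^ m) * h)) (at s)" for s
    using termdiffs_strong_converges_everywhere[OF entire_alg_series]
    by (simp add: has_field_derivative_def mult_commute_abs)
  let ?f' = "\<lambda>x h. (\<Sum>m. diffs c m * (x \<bullet> x) ^ m) * (2 * (x \<bullet> h))"
  have "((\<lambda>x. x \<bullet> x) has_derivative (\<lambda>h. 2 * (x \<bullet> h))) (at x)" for x :: 'a
    by (auto intro!: derivative_eq_intros simp: inner_commute)
  from has_derivative_compose[OF this F]
  have "((\<lambda>x. \<Sum>m. c m * (x \<bullet> x) ^ m) has_derivative ?f' x) (at x)" for x :: 'a
    by simp
  moreover have "entire_alg (\<lambda>x. ?f' x b)" for b :: 'a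
    by (intro entire_alg.entire_alg_mult entire_alg.entire_alg_inner
        entire_alg.entire_alg_const entire_alg.entire_alg_series termdiff_converges_all
        entire_alg_series)
  ultimately show ?case by (intro exI[of _ ?f']) simp
next
  case (entire_alg_inner b)
  have "((\<lambda>x. x \<bullet> b) has_derivative (\<lambda>h. h \<bullet> b)) (at x)" for x
    by (auto intro!: derivative_eq_intros)
  then show ?case
    by (intro exI[of _ "\<lambda>x h. h \<bullet> b"]) (simp add: entire_alg.entire_alg_const)
next
  case (entire_alg_const a)
  show ?case by (intro exI[of _ "\<lambda>x h. 0"]) (simp add: entire_alg.entire_alg_const)
next
  case (entire_alg_add f g)
  then obtain f' g' where "\<And>x. (f has_derivative f' x) (at x)" "\<And>x. (g has_derivative g' x) (at x)"
    and "\<And>b. entire_alg (\<lambda>x. f' x b)" "\<And>b. entire_alg (\<lambda>x. g' x b)" by blast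
  then show ?case
    by (intro exI[of _ "\<lambda>x h. f' x h + g' x h"])
      (auto intro!: derivative_intros entire_alg.intros)
next
  case (entire_alg_mult f g)
  then obtain f' g' where "\<And>x. (f has_derivative f' x) (at x)" "\<And>x. (g has_derivative g' x) (at x)"
    and "\<And>b. entire_alg (\<lambda>x. f' x b)" "\<And>b. entire_alg (\<lambda>x. g' x b)" by blast
  then show ?case using entire_alg_mult.hyps
    by (intro exI[of _ "\<lambda>x h. f x * g' x h + f' x h * g x"])
      (auto intro!: has_derivative_mult entire_alg.entire_alg_add entire_alg.entire_alg_mult)
qed

lemma entire_alg_smooth: "entire_alg f \<Longrightarrow> smooth_fun f"
proof (coinduction arbitrary: f)
  case smooth_fun
  then obtain f' where f': "\<And>x. (f has_derivative f' x) (at x)" "\<And>b. entire_alg (\<lambda>x. f' x b)"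
    using entire_alg_has_derivative by blast
  then have "frechet_derivative f (at x) = f' x" for x
    using frechet_derivative_at by metis
  with f' show ?case by (auto simp: differentiable_def)
qed

text \<open>\<open>L\<close> need not be monotone, so an index is returned that serves both as a
  radius and as the index of the dominated value.\<close>

lemma ex_smooth_majorant:
  fixes L :: "nat \<Rightarrow> real"
  obtains \<rho> :: "'a::euclidean_space \<Rightarrow> real" where "smooth_fun \<rho>" "\<And>x. \<rho> x \<ge> 1"
    "\<And>x. \<exists>n. norm x \<le> real n \<and> L n \<le> \<rho> x"
proof -
  \<comment> \<open>The shift by 2 turns |x|^2 \<le> n + 1 into a bound on |x| itself, by 2 |x|
    \<le> |x|^2 + 1.\<close>
  obtain c :: "nat \<Rightarrow> real" where c: "\<And>m. c m \<ge> 0" "\<And>s. summable (\<lambda>m. c m * s ^ m)"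
    "\<And>n s. real n \<le> s \<Longrightarrow> s \<le> real n + 1 \<Longrightarrow> L (n + 2) \<le> (\<Sum>m. c m * s ^ m)"
    using ex_entire_series_majorant[of "\<lambda>n. L (n + 2)"] by blast
  define \<rho> where "\<rho> x = (\<Sum>m. c m * (x \<bullet> x) ^ m) + 1" for x :: 'a
  have "smooth_fun \<rho>" unfolding \<rho>_def
    by (intro entire_alg_smooth entire_alg.intros c)
  moreover have "\<rho> x \<ge> 1" for x
    unfolding \<rho>_def using c by (auto intro!: suminf_nonneg)
  moreover have "\<exists>n. norm x \<le> real n \<and> L n \<le> \<rho> x" for x
  proof -
    define n where "n = nat \<lfloor>x \<bullet> x\<rfloor>"
    have n: "real n \<le> x \<bullet> x" "x \<bullet> x \<le> real n + 1"
      using inner_ge_zero[of x] unfolding n_def by linarith+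
    have "2 * norm x \<le> (norm x)\<^sup>2 + 1"
      using sum_squares_bound[of "norm x" 1] by simp
    then have "norm x \<le> real (n + 2)"
      using n by (simp add: power2_norm_eq_inner)
    then show ?thesis using c(3)[OF n] unfolding \<rho>_def by (intro exI[of _ "n + 2"]) auto
  qed
  ultimately show thesis using that by blast
qed

section \<open>A Barbalat lemma\<close>

text \<open>Over a short window \<open>h\<close> is nearly constant, so the increment of
  \<open>x\<close> is close to the window length times \<open>h t\<close>, and convergence of
  \<open>x\<close> makes that increment small. The part \<open>g\<close> is split off because only
  its limit is known.\<close>

lemma tendsto_zero_of_lipschitz_derivative:
  fixes x :: "real \<Rightarrow> 'a::real_normed_vector"
  assumes x': "\<And>t. t \<ge> 0 \<Longrightarrow> (x has_vector_derivative h t + g t) (at t within {0..})"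
    and x: "(x \<longlongrightarrow> l) at_top" and g: "(g \<longlongrightarrow> 0) at_top"
    and h: "\<And>s t. s \<ge> 0 \<Longrightarrow> t \<ge> 0 \<Longrightarrow> norm (h s - h t) \<le> L * \<bar>s - t\<bar>"
  shows "(h \<longlongrightarrow> 0) at_top"
proof (rule tendstoI)
  fix e :: real assume e: "e > 0"
  \<comment> \<open>\<open>M\<close> is positive whatever the sign of \<open>L\<close>, and
    \<open>d\<close> lets \<open>h\<close> vary by at most e/8. The errors add up in eighths: 3 from
    the linearization (one for \<open>h\<close>, two for \<open>g\<close>), 2 from the endpoints, 1
    from removing \<open>g\<close>.\<close>
  define M where "M = \<bar>L\<bar> + 1"
  define d where "d = e / (8 * M)"
  have M: "M > 0" "L \<le> M" by (auto simp: M_def)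
  then have d: "d > 0" "M * d = e / 8" using e by (auto simp: d_def)
  have "\<forall>\<^sub>F t in at_top. dist (x t) l < d * e / 8" "\<forall>\<^sub>F t in at_top. dist (g t) 0 < e / 8"
    using tendstoD[OF x, of "d * e / 8"] tendstoD[OF g, of "e / 8"] d(1) e by simp_all
  then have "\<forall>\<^sub>F t in at_top. dist (x t) l < d * e / 8 \<and> dist (g t) 0 < e / 8 \<and> t \<ge> 0"
    using eventually_ge_at_top by (auto elim: eventually_elim2 intro!: eventually_conj)
  then obtain T where T: "\<And>t. t \<ge> T \<Longrightarrow> dist (x t) l < d * e / 8 \<and> dist (g t) 0 < e / 8 \<and> t \<ge> 0"
    unfolding eventually_at_top_linorder by blast
  show "\<forall>\<^sub>F t in at_top. dist (h t) 0 < e"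
    unfolding eventually_at_top_linorder
  proof (intro exI allI impI)
    fix t assume t: "t \<ge> T"
    have t0: "t \<ge> 0" using T t by blast
    have "norm (x (t + d) - x t - (t + d - t) *\<^sub>R (h t + g t)) \<le> norm (t + d - t) * (3 * e / 8)"
    proof (rule vector_differentiable_bound_linearization[where S = "{t..t + d}"])
      fix s assume s: "s \<in> {t..t + d}"
      then have s0: "s \<ge> 0" using t0 by auto
      show "(x has_vector_derivative h s + g s) (at s within {t..t + d})"
        by (rule has_vector_derivative_within_subset[OF x'[OF s0]]) (use t0 in auto)
      have "norm (h s - h t) \<le> L * \<bar>s - t\<bar>" using h s0 t0 by blast
      also have "\<dots> \<le> M * d" using s M by (intro mult_mono) auto
      finally have "norm (h s - h t) \<le> e / 8" using d by simp
      moreover have "norm (g s) < e / 8" "norm (g t) < e / 8" using T[of s] T[of t] s t by auto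
      ultimately show "norm (h s + g s - (h t + g t)) \<le> 3 * e / 8"
        using norm_triangle_ineq[of "h s - h t" "g s - g t"] norm_triangle_ineq4[of "g s" "g t"]
        by (simp add: algebra_simps)
    qed (use d in \<open>auto simp: closed_segment_eq_real_ivl\<close>)
    then have 1: "norm (x (t + d) - x t - d *\<^sub>R (h t + g t)) \<le> d * (3 * e / 8)" using d by simp
    have "dist (x (t + d)) (x t) < d * e / 4"
      using T[of t] T[of "t + d"] t d dist_triangle2[of "x (t + d)" "x t" l] by auto
    then have "norm (d *\<^sub>R (h t + g t)) \<le> d * (3 * e / 8) + d * e / 4"
      using 1 norm_triangle_ineq4[of "x (t + d) - x t" "x (t + d) - x t - d *\<^sub>R (h t + g t)"]
      by (simp add: dist_norm)
    also have "\<dots> = d * (5 * e / 8)" by (simp add: algebra_simps)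
    finally have "norm (h t + g t) \<le> 5 * e / 8" using d by simp
    moreover have "norm (g t) < e / 8" using T t by auto
    ultimately show "dist (h t) 0 < e"
      using norm_triangle_ineq4[of "h t + g t" "g t"] e by simp
  qed
qed

section \<open>Bounded Lipschitz maps\<close>

text \<open>\<open>D p q d\<close> is read as ``\<open>p\<close> and \<open>q\<close> are at distance at most \<open>d\<close>''. Keeping it abstract lets one
  set of closure rules serve for Lipschitz continuity in the state, for Lipschitz continuity in time,
  and (with the empty relation) for boundedness alone.\<close>

definition blip :: "'p set \<Rightarrow> ('p \<Rightarrow> 'p \<Rightarrow> real \<Rightarrow> bool) \<Rightarrow> ('p \<Rightarrow> 'b::real_normed_vector) \<Rightarrow> bool" where
  "blip S D F \<longleftrightarrow> (\<exists>B\<ge>0. \<forall>p\<in>S. norm (F p) \<le> B) \<and>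
     (\<exists>L\<ge>0. \<forall>p\<in>S. \<forall>q\<in>S. \<forall>d\<ge>0. D p q d \<longrightarrow> norm (F p - F q) \<le> L * d)"

lemma blipI:
  assumes "\<And>p. p \<in> S \<Longrightarrow> norm (F p) \<le> B"
    and "\<And>p q d. p \<in> S \<Longrightarrow> q \<in> S \<Longrightarrow> d \<ge> 0 \<Longrightarrow> D p q d \<Longrightarrow> norm (F p - F q) \<le> L * d"
  shows "blip S D F"
proof -
  have "norm (F p) \<le> \<bar>B\<bar>" if "p \<in> S" for p
    using assms(1)[OF that] by linarith
  moreover have "norm (F p - F q) \<le> \<bar>L\<bar> * d" if "p \<in> S" "q \<in> S" "d \<ge> 0" "D p q d" for p q d
    using assms(2)[OF that] mult_right_mono[OF abs_ge_self[of L] that(3)] by linarith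
  ultimately show ?thesis unfolding blip_def by (meson abs_ge_zero)
qed

lemma blipE:
  assumes "blip S D F"
  obtains B L where "B \<ge> 0" "L \<ge> 0" "\<And>p. p \<in> S \<Longrightarrow> norm (F p) \<le> B"
    "\<And>p q d. p \<in> S \<Longrightarrow> q \<in> S \<Longrightarrow> d \<ge> 0 \<Longrightarrow> D p q d \<Longrightarrow> norm (F p - F q) \<le> L * d"
  using assms unfolding blip_def by blast

lemma blip_const: "blip S D (\<lambda>p. c)"
  by (rule blipI[of _ _ "norm c" _ 0]) auto

text \<open>Smooth maps are Lipschitz only on balls; the bound carried by \<open>blip\<close>
  supplies the ball. Hence both properties sit in one predicate.\<close>

lemma blip_smooth:
  fixes F :: "'p \<Rightarrow> 'a::euclidean_space"
  assumes F: "blip S D F" and f: "smooth_fun f"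
  shows "blip S D (\<lambda>p. f (F p))"
proof -
  obtain B L where BL: "B \<ge> 0" "L \<ge> 0" "\<And>p. p \<in> S \<Longrightarrow> norm (F p) \<le> B"
    "\<And>p q d. p \<in> S \<Longrightarrow> q \<in> S \<Longrightarrow> d \<ge> 0 \<Longrightarrow> D p q d \<Longrightarrow> norm (F p - F q) \<le> L * d"
    using blipE[OF F] by blast
  obtain M where M: "M \<ge> 0" "\<And>x y. norm x \<le> B \<Longrightarrow> norm y \<le> B \<Longrightarrow> norm (f x - f y) \<le> M * norm (x - y)"
    using smooth_fun_lipschitz_on_cball[OF f] by blast
  show ?thesis
  proof (rule blipI)
    fix p assume p: "p \<in> S"
    have "norm (f (F p) - f 0) \<le> M * norm (F p - 0)" using BL p by (intro M) auto
    also have "\<dots> \<le> M * B" using BL(3)[OF p] M by (simp add: mult_left_mono)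
    finally show "norm (f (F p)) \<le> norm (f 0) + M * B"
      using norm_triangle_ineq2[of "f (F p)" "f 0"] by linarith
  next
    fix p q d assume *: "p \<in> S" "q \<in> S" "(d::real) \<ge> 0" "D p q d"
    have "norm (f (F p) - f (F q)) \<le> M * norm (F p - F q)" using BL * by (intro M) auto
    also have "\<dots> \<le> M * (L * d)" using BL(4)[OF *] M by (simp add: mult_left_mono)
    finally show "norm (f (F p) - f (F q)) \<le> (M * L) * d" by simp
  qed
qed

lemma (in bounded_linear) blip:
  assumes F: "blip S D F"
  shows "blip S D (\<lambda>p. f (F p))"
proof -
  obtain B L where BL: "B \<ge> 0" "L \<ge> 0" "\<And>p. p \<in> S \<Longrightarrow> norm (F p) \<le> B"
    "\<And>p q d. p \<in> S \<Longrightarrow> q \<in> S \<Longrightarrow> d \<ge> 0 \<Longrightarrow> D p q d \<Longrightarrow> norm (F p - F q) \<le> L * d"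
    using blipE[OF F] by blast
  obtain K where K: "K \<ge> 0" "\<And>x. norm (f x) \<le> norm x * K" using nonneg_bounded by blast
  show ?thesis
  proof (rule blipI)
    fix p assume p: "p \<in> S"
    have "norm (f (F p)) \<le> norm (F p) * K" by (rule K)
    also have "\<dots> \<le> B * K" using BL(3)[OF p] K(1) by (simp add: mult_right_mono)
    finally show "norm (f (F p)) \<le> B * K" .
  next
    fix p q d assume *: "p \<in> S" "q \<in> S" "(d::real) \<ge> 0" "D p q d"
    have "norm (f (F p - F q)) \<le> norm (F p - F q) * K" by (rule K)
    also have "\<dots> \<le> (L * d) * K" using BL(4)[OF *] K(1) by (simp add: mult_right_mono)
    finally show "norm (f (F p) - f (F q)) \<le> (L * K) * d" by (simp add: diff mult_ac)
  qed
qed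

lemma (in bounded_bilinear) blip:
  assumes F: "blip S D F" and G: "blip S D G"
  shows "blip S D (\<lambda>p. prod (F p) (G p))"
proof -
  obtain B L where BL: "B \<ge> 0" "L \<ge> 0" "\<And>p. p \<in> S \<Longrightarrow> norm (F p) \<le> B"
    "\<And>p q d. p \<in> S \<Longrightarrow> q \<in> S \<Longrightarrow> d \<ge> 0 \<Longrightarrow> D p q d \<Longrightarrow> norm (F p - F q) \<le> L * d"
    using blipE[OF F] by blast
  obtain B' L' where BL': "B' \<ge> 0" "L' \<ge> 0" "\<And>p. p \<in> S \<Longrightarrow> norm (G p) \<le> B'"
    "\<And>p q d. p \<in> S \<Longrightarrow> q \<in> S \<Longrightarrow> d \<ge> 0 \<Longrightarrow> D p q d \<Longrightarrow> norm (G p - G q) \<le> L' * d"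
    using blipE[OF G] by blast
  obtain K where K: "K \<ge> 0" "\<And>x y. norm (prod x y) \<le> norm x * norm y * K"
    using nonneg_bounded by blast
  show ?thesis
  proof (rule blipI)
    fix p assume p: "p \<in> S"
    have "norm (prod (F p) (G p)) \<le> norm (F p) * norm (G p) * K" by (rule K)
    also have "\<dots> \<le> B * B' * K"
      using BL(1,3) BL'(1,3) p K(1) by (intro mult_mono) auto
    finally show "norm (prod (F p) (G p)) \<le> B * B' * K" .
  next
    fix p q d assume *: "p \<in> S" "q \<in> S" "(d::real) \<ge> 0" "D p q d"
    have "norm (prod (F p) (G p) - prod (F q) (G q))
        = norm (prod (F p - F q) (G p) + prod (F q) (G p - G q))"
      by (simp add: diff_left diff_right)
    also have "\<dots> \<le> norm (F p - F q) * norm (G p) * K + norm (F q) * norm (G p - G q) * K"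
      using K norm_triangle_le add_mono by metis
    also have "\<dots> \<le> (L * d) * B' * K + B * (L' * d) * K"
      using BL BL' * K(1) by (intro add_mono mult_mono) auto
    finally show "norm (prod (F p) (G p) - prod (F q) (G q)) \<le> (L * B' * K + B * L' * K) * d"
      by (simp add: algebra_simps)
  qed
qed

lemma blip_add:
  assumes F: "blip S D F" and G: "blip S D G"
  shows "blip S D (\<lambda>p. F p + G p)"
proof -
  obtain B L where BL: "B \<ge> 0" "L \<ge> 0" "\<And>p. p \<in> S \<Longrightarrow> norm (F p) \<le> B"
    "\<And>p q d. p \<in> S \<Longrightarrow> q \<in> S \<Longrightarrow> d \<ge> 0 \<Longrightarrow> D p q d \<Longrightarrow> norm (F p - F q) \<le> L * d"
    using blipE[OF F] by blast
  obtain B' L' where BL': "B' \<ge> 0" "L' \<ge> 0" "\<And>p. p \<in> S \<Longrightarrow> norm (G p) \<le> B'"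
    "\<And>p q d. p \<in> S \<Longrightarrow> q \<in> S \<Longrightarrow> d \<ge> 0 \<Longrightarrow> D p q d \<Longrightarrow> norm (G p - G q) \<le> L' * d"
    using blipE[OF G] by blast
  show ?thesis
  proof (rule blipI)
    fix p assume "p \<in> S"
    then show "norm (F p + G p) \<le> B + B'" using BL(3) BL'(3) by (meson norm_add_rule_thm)
  next
    fix p q d assume *: "p \<in> S" "q \<in> S" "(d::real) \<ge> 0" "D p q d"
    show "norm (F p + G p - (F q + G q)) \<le> (L + L') * d"
      using norm_diff_triangle_ineq[of "F p" "G p" "F q" "G q"] BL(4)[OF *] BL'(4)[OF *]
      by (simp add: algebra_simps)
  qed
qed

lemma blip_diff:
  assumes "blip S D F" "blip S D G"
  shows "blip S D (\<lambda>p. F p - G p)"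
  using blip_add[OF assms(1) bounded_linear.blip[OF bounded_linear_minus[OF bounded_linear_ident] assms(2)]]
  by simp

lemma blip_sum:
  assumes "\<And>i. i \<in> I \<Longrightarrow> blip S D (F i)"
  shows "blip S D (\<lambda>p. \<Sum>i\<in>I. F i p)"
  using assms by (induction I rule: infinite_finite_induct) (auto intro: blip_const blip_add)

lemma blip_Pair:
  assumes "blip S D F" "blip S D G"
  shows "blip S D (\<lambda>p. (F p, G p))"
proof -
  have "bounded_linear (\<lambda>x. (x::'b, 0::'c))" "bounded_linear (\<lambda>x. (0::'b, x::'c))"
    by (intro bounded_linear_Pair bounded_linear_ident bounded_linear_zero)+
  from blip_add[OF bounded_linear.blip[OF this(1) assms(1)] bounded_linear.blip[OF this(2) assms(2)]]
  show ?thesis by simp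
qed

text \<open>Projection onto a convex set is nonexpansive, so truncating to a ball keeps Lipschitz
  dependence and creates the boundedness that the raw state lacks.\<close>

lemma blip_closest_point:
  fixes F :: "'p \<Rightarrow> 'a::euclidean_space"
  assumes R: "R \<ge> 0" and F: "\<And>p q d. D p q d \<Longrightarrow> norm (F p - F q) \<le> d"
  shows "blip S D (\<lambda>p. closest_point (cball 0 R) (F p))"
proof (rule blipI)
  have ne: "cball (0::'a) R \<noteq> {}" using R by simp
  show "norm (closest_point (cball 0 R) (F p)) \<le> R" for p
    using closest_point_in_set[OF closed_cball ne, of "F p"] by simp
  fix p q d assume "D p q d"
  then show "norm (closest_point (cball 0 R) (F p) - closest_point (cball 0 R) (F q)) \<le> 1 * d"
    using closest_point_lipschitz[OF convex_cball closed_cball ne, of "F p" "F q"] F[of p q d]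
    by (simp add: dist_norm)
qed

section \<open>Matrix operations as bounded linear and bilinear maps\<close>

lemma bounded_bilinear_matrix_vector_mult:
  "bounded_bilinear ((*v) :: real^'n^'m \<Rightarrow> real^'n \<Rightarrow> real^'m)"
  unfolding bilinear_conv_bounded_bilinear[symmetric] bilinear_def
  by (auto intro!: linearI simp: matrix_vector_mult_add_rdistrib matrix_vector_right_distrib
      scaleR_matrix_vector_assoc[symmetric] matrix_vector_mult_scaleR)

lemma bounded_linear_transpose: "bounded_linear (transpose :: real^'n^'m \<Rightarrow> real^'m^'n)"
  unfolding linear_conv_bounded_linear[symmetric]
  by (rule linearI) (simp_all add: transpose_def vec_eq_iff)

section \<open>Global solutions of bounded Lipschitz differential equations\<close>

text \<open>Points of the first factor are open, so a neighbourhood of \<open>(i, t)\<close> can be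
  taken inside one slice. Functions on this product encode families of curves.\<close>

lemma continuous_on_discrete_prod:
  fixes f :: "'i discrete \<times> real \<Rightarrow> 'a::topological_space"
  assumes "\<And>i. continuous_on UNIV (\<lambda>t. f (i, t))"
  shows "continuous_on UNIV f"
  unfolding continuous_on_def
proof (intro ballI)
  fix p :: "'i discrete \<times> real"
  obtain i t where p: "p = (i, t)" by force
  have lim: "((\<lambda>t. f (i, t)) \<longlongrightarrow> f (i, t)) (nhds t)"
    using assms[of i] tendsto_at_iff_tendsto_nhds[of "\<lambda>t. f (i, t)" t]
    by (simp add: continuous_on_def)
  have "(f \<longlongrightarrow> f p) (nhds i \<times>\<^sub>F nhds t)"
  proof (rule topological_tendstoI)
    fix S assume "open S" "f p \<in> S"
    then have "\<forall>\<^sub>F s in nhds t. f (i, s) \<in> S" using topological_tendstoD[OF lim] p by blast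
    then show "\<forall>\<^sub>F q in nhds i \<times>\<^sub>F nhds t. f q \<in> S"
      unfolding eventually_prod_filter nhds_discrete_open[OF open_discrete] eventually_principal
      by (intro exI[of _ "\<lambda>j. j = i"] exI[of _ "\<lambda>s. f (i, s) \<in> S"]) auto
  qed
  then have "(f \<longlongrightarrow> f p) (nhds p)" by (simp add: p nhds_prod)
  then show "(f \<longlongrightarrow> f p) (at p within UNIV)" by (simp add: tendsto_at_iff_tendsto_nhds)
qed

lemma has_vector_derivative_integral_ge_0:
  fixes f :: "real \<Rightarrow> 'a::banach"
  assumes f: "continuous_on {0..} f" and t: "t \<ge> 0"
  shows "((\<lambda>u. integral {0..u} f) has_vector_derivative f t) (at t within {0..})"
proof -
  have "((\<lambda>u. integral {0..u} f) has_vector_derivative f t) (at t within {0..t + 1})"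
    using t by (intro integral_has_vector_derivative continuous_on_subset[OF f]) auto
  moreover have "at t within {0..t + 1} = at t within {0..}"
    by (rule at_within_nhd[of _ "{..<t + 1}"]) auto
  ultimately show ?thesis by simp
qed

text \<open>Closeness requires equal times, so \<open>blip states state_close\<close> means bounded
  and Lipschitz in the state, uniformly in time.\<close>

abbreviation (input) "states \<equiv> {(t::real, x). t \<ge> 0}"
abbreviation (input) "state_close \<equiv> (\<lambda>(t::real, x) (s, y) d. s = t \<and> (\<forall>j. norm (x j - y j) \<le> d))"

text \<open>Finitely many coupled equations with a number of components that is not fixed by a type are
  solved in the Banach space of bounded continuous functions on \<open>nat discrete \<times> real\<close>. Weighting
  the state by \<open>exp (- K * t)\<close> makes the Picard operator a contraction on the whole half-line.\<close>

lemma ex_solution_blip_ode: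
  fixes G :: "nat \<Rightarrow> real \<Rightarrow> (nat \<Rightarrow> 'e::banach) \<Rightarrow> 'e"
  assumes fin: "finite I"
    and G: "\<And>i. i \<in> I \<Longrightarrow> blip states state_close (\<lambda>(t, x). G i t x)"
    and cont: "\<And>i x. i \<in> I \<Longrightarrow> (\<And>j. continuous_on {0..} (x j)) \<Longrightarrow>
      continuous_on {0..} (\<lambda>t. G i t (\<lambda>j. x j t))"
  obtains x where "\<And>i. i \<in> I \<Longrightarrow> x i 0 = x0 i"
    "\<And>i t. i \<in> I \<Longrightarrow> t \<ge> 0 \<Longrightarrow> (x i has_vector_derivative G i t (\<lambda>j. x j t)) (at t within {0..})"
proof -
  define Q where "Q i B L \<longleftrightarrow> B \<ge> 0 \<and> L \<ge> 0 \<and> (\<forall>t x. t \<ge> 0 \<longrightarrow> norm (G i t x) \<le> B) \<and>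
      (\<forall>t x y d. t \<ge> 0 \<longrightarrow> d \<ge> 0 \<longrightarrow> (\<forall>j. norm (x j - y j) \<le> d) \<longrightarrow> norm (G i t x - G i t y) \<le> L * d)"
    for i B L
  have "\<exists>p. Q i (fst p) (snd p)" if i: "i \<in> I" for i
  proof (rule blipE[OF G[OF i]])
    fix B L assume "B \<ge> 0" "L \<ge> 0"
      and 1: "\<And>p. p \<in> states \<Longrightarrow> norm (case p of (t, x) \<Rightarrow> G i t x) \<le> B"
      and 2: "\<And>p q d. p \<in> states \<Longrightarrow> q \<in> states \<Longrightarrow> d \<ge> 0 \<Longrightarrow> state_close p q d \<Longrightarrow>
        norm ((case p of (t, x) \<Rightarrow> G i t x) - (case q of (t, x) \<Rightarrow> G i t x)) \<le> L * d"
    have "norm (G i t x) \<le> B" if "t \<ge> 0" for t x using 1[of "(t, x)"] that by simp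
    moreover have "norm (G i t x - G i t y) \<le> L * d"
      if "t \<ge> 0" "d \<ge> 0" "\<forall>j. norm (x j - y j) \<le> d" for t x y d
      using 2[of "(t, x)" "(t, y)" d] that by simp
    ultimately have "Q i B L" using \<open>B \<ge> 0\<close> \<open>L \<ge> 0\<close> by (simp add: Q_def)
    then show ?thesis by (intro exI[of _ "(B, L)"]) simp
  qed
  then obtain BL where BL: "\<And>i. i \<in> I \<Longrightarrow> Q i (fst (BL i)) (snd (BL i))" by metis
  define B where "B i = fst (BL i)" for i
  define L where "L i = snd (BL i)" for i
  have B0: "B i \<ge> 0" and L0: "L i \<ge> 0" and G_bound: "\<And>t x. t \<ge> 0 \<Longrightarrow> norm (G i t x) \<le> B i"
    and G_lip: "\<And>t x y d. t \<ge> 0 \<Longrightarrow> d \<ge> 0 \<Longrightarrow> (\<And>j. norm (x j - y j) \<le> d) \<Longrightarrow>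
      norm (G i t x - G i t y) \<le> L i * d" if "i \<in> I" for i
    using BL[OF that] by (simp_all add: Q_def B_def L_def)
  define b where "b = (\<Sum>i\<in>I. B i)"
  define l where "l = (\<Sum>i\<in>I. L i)"
  define c where "c = (\<Sum>i\<in>I. norm (x0 i))"
  have b0: "b \<ge> 0" and l0: "l \<ge> 0" and c0: "c \<ge> 0" using B0 L0 by (auto simp: b_def l_def c_def sum_nonneg)
  have B_le: "B i \<le> b" and L_le: "L i \<le> l" and c_le: "norm (x0 i) \<le> c" if "i \<in> I" for i
    using that B0 L0 fin unfolding b_def l_def c_def by (auto intro!: member_le_sum)
  \<comment> \<open>Extension by zero outside \<open>I\<close> gives every index an equation with
    the same constants, so the fixed point can be sought over all of \<open>nat\<close>.\<close>
  define H where "H i t x = (if i \<in> I then G i t x else 0)" for i t x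
  define X0 where "X0 i = (if i \<in> I then x0 i else 0)" for i
  \<comment> \<open>The contraction factor will be \<open>l / K\<close>, at most 1/2;
    \<open>K \<ge> 1\<close> also gives s \<le> exp (K s), which bounds the weighted
    integral.\<close>
  define K where "K = 2 * l + 1"
  have K: "K \<ge> 1" "l \<le> K / 2" using l0 by (auto simp: K_def)
  have H_bound: "norm (H i t x) \<le> b" if "t \<ge> 0" for i t x
    using G_bound[OF _ that, of i x] B_le[of i] b0 by (auto simp: H_def)
  have H_lip: "norm (H i t x - H i t y) \<le> l * d"
    if "t \<ge> 0" "d \<ge> 0" "\<And>j. norm (x j - y j) \<le> d" for i t x y d
  proof (cases "i \<in> I")
    case True
    then have "norm (H i t x - H i t y) \<le> L i * d" using G_lip[of i t d x y] that by (simp add: H_def)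
    also have "\<dots> \<le> l * d" using L_le[OF True] that by (simp add: mult_right_mono)
    finally show ?thesis .
  qed (use l0 that in \<open>simp add: H_def\<close>)
  have H_cont: "continuous_on {0..} (\<lambda>t. H i t (\<lambda>j. x j t))" if "\<And>j. continuous_on {0..} (x j)" for i x
    using cont[of i x] that by (cases "i \<in> I") (auto simp: H_def)
  define rhs where "rhs y i u = H i u (\<lambda>j. exp (K * u) *\<^sub>R apply_bcontfun y (discrete j, u))"
    for y :: "(nat discrete \<times> real) \<Rightarrow>\<^sub>C 'e" and i u
  have rhs_cont: "continuous_on {0..} (rhs y i)" for y i
    unfolding rhs_def
    by (intro H_cont continuous_intros continuous_on_compose2[OF continuous_on_apply_bcontfun]) auto
  then have rhs_int: "rhs y i integrable_on {0..t}" for y i t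
    by (intro integrable_continuous_real continuous_on_subset[OF rhs_cont]) auto
  define sol where "sol y i t = X0 i + integral {0..t} (rhs y i)" for y i t
  \<comment> \<open>\<open>y\<close> is the weighted state: \<open>rhs\<close> undoes the weight
    before evaluating the field, and \<open>T\<close> applies it again. \<open>max 0 t\<close>
    extends curves to negative times, since the function space lives on the whole type.\<close>
  define T where "T y = (\<lambda>(i, t). exp (- K * max 0 t) *\<^sub>R sol y (of_discrete i) (max 0 t))" for y
  have sol_deriv: "(sol y i has_vector_derivative rhs y i t) (at t within {0..})" if "t \<ge> 0" for y i t
    unfolding sol_def
    using has_vector_derivative_add[OF has_vector_derivative_const
        has_vector_derivative_integral_ge_0[OF rhs_cont that]] by simp
  have T_bcontfun: "T y \<in> bcontfun" for y
  proof (rule bcontfun_normI)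
    have "continuous_on {0..} (sol y i)" for i
      by (rule continuous_on_vector_derivative) (use sol_deriv in auto)
    then have "continuous_on UNIV (\<lambda>t. sol y i (max 0 t))" for i
      by (rule continuous_on_compose2) (auto intro!: continuous_on_max continuous_on_const continuous_on_id)
    then show "continuous_on UNIV (T y)"
      unfolding T_def
      by (intro continuous_on_discrete_prod) (simp, intro continuous_intros)
    show "norm (T y p) \<le> c + b" for p
    proof (cases p)
      case (Pair di t)
      define i where "i = of_discrete di"
      define s where "s = max 0 t"
      have s: "s \<ge> 0" by (simp add: s_def)
      have "norm (integral {0..s} (rhs y i)) \<le> integral {0..s} (\<lambda>_. b)"
        by (rule integral_norm_bound_integral) (use rhs_int H_bound in \<open>auto simp: rhs_def\<close>)
      also have "\<dots> = b * s" using s by simp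
      finally have 1: "norm (sol y i s) \<le> c + b * s"
        unfolding sol_def X0_def using c_le[of i] c0
        by (intro norm_triangle_le add_mono) auto
      have "s \<le> exp s" using exp_ge_add_one_self[of s] by linarith
      also have "\<dots> \<le> exp (K * s)" using mult_right_mono[OF K(1) s] by simp
      finally have "b * s \<le> b * exp (K * s)" using b0 by (rule mult_left_mono)
      moreover have "c * 1 \<le> c * exp (K * s)" using c0 s K by (intro mult_left_mono) auto
      ultimately have "norm (sol y i s) \<le> (c + b) * exp (K * s)" using 1 by (simp add: algebra_simps)
      then have "exp (- K * s) * norm (sol y i s) \<le> exp (- K * s) * ((c + b) * exp (K * s))"
        by (rule mult_left_mono) simp
      also have "\<dots> = c + b" by (simp add: exp_minus field_simps)
      finally show ?thesis unfolding Pair T_def by (simp add: s_def i_def)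
    qed
  qed
  define TT where "TT y = Bcontfun (T y)" for y
  have TT: "apply_bcontfun (TT y) = T y" for y
    unfolding TT_def using T_bcontfun by (simp add: Bcontfun_inverse)
  have "dist (TT y) (TT y') \<le> 1/2 * dist y y'" for y y'
  proof (rule dist_bound)
    fix p show "dist (apply_bcontfun (TT y) p) (apply_bcontfun (TT y') p) \<le> 1/2 * dist y y'"
    proof (cases p)
      case (Pair di t)
      define i where "i = of_discrete di"
      define s where "s = max 0 t"
      have s: "s \<ge> 0" by (simp add: s_def)
      define \<delta> where "\<delta> = dist y y'"
      have \<delta>: "\<delta> \<ge> 0" by (simp add: \<delta>_def)
      \<comment> \<open>Unweighted states differ by at most exp (K u) \<delta>; integration gains
        the factor 1 / K and the outer weight removes the exponential.\<close>
      have ptw: "norm (rhs y i u - rhs y' i u) \<le> l * \<delta> * exp (K * u)" if "u \<in> {0..s}" for u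
      proof -
        have "norm (exp (K * u) *\<^sub>R apply_bcontfun y (discrete j, u) - exp (K * u) *\<^sub>R apply_bcontfun y' (discrete j, u))
            \<le> exp (K * u) * \<delta>" for j
          using dist_bounded[of y "(discrete j, u)" y'] unfolding scaleR_diff_right[symmetric] \<delta>_def
          by (simp add: dist_norm)
        then have "norm (rhs y i u - rhs y' i u) \<le> l * (exp (K * u) * \<delta>)"
          unfolding rhs_def using that \<delta> by (intro H_lip) auto
        then show ?thesis by (simp add: mult_ac)
      qed
      have "((\<lambda>u. l * \<delta> * exp (K * u)) has_integral
          (l * \<delta> * exp (K * s) / K - l * \<delta> * exp (K * 0) / K)) {0..s}"
        by (rule fundamental_theorem_of_calculus[OF s])
          (use K in \<open>auto intro!: derivative_eq_intros simp: has_real_derivative_iff_has_vector_derivative[symmetric]\<close>)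
      then have int: "(\<lambda>u. l * \<delta> * exp (K * u)) integrable_on {0..s}"
        "integral {0..s} (\<lambda>u. l * \<delta> * exp (K * u)) = l * \<delta> * exp (K * s) / K - l * \<delta> / K"
        by (auto dest: integral_unique simp del: integral_mult_right)
      have "sol y i s - sol y' i s = integral {0..s} (\<lambda>u. rhs y i u - rhs y' i u)"
        unfolding sol_def by (simp add: integral_diff rhs_int)
      also have "norm \<dots> \<le> integral {0..s} (\<lambda>u. l * \<delta> * exp (K * u))"
        by (rule integral_norm_bound_integral) (use ptw int rhs_int in \<open>auto intro!: integrable_diff\<close>)
      also have "\<dots> \<le> l * \<delta> * exp (K * s) / K"
        unfolding int(2) using l0 \<delta> K by simp
      finally have "exp (- K * s) * norm (sol y i s - sol y' i s) \<le> exp (- K * s) * (l * \<delta> * exp (K * s) / K)"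
        by (rule mult_left_mono) simp
      also have "\<dots> = l / K * \<delta>" by (simp add: exp_minus field_simps)
      also have "\<dots> \<le> 1/2 * \<delta>" using K \<delta> by (intro mult_right_mono) (auto simp: field_simps)
      finally show ?thesis
        unfolding TT Pair T_def \<delta>_def by (simp add: s_def i_def dist_norm scaleR_diff_right[symmetric])
    qed
  qed
  then have "\<exists>!y. TT y = y" using banach_fix_type[where c = "1/2" and f = TT] by auto
  then obtain y where y: "TT y = y" by blast
  define x where "x i t = exp (K * t) *\<^sub>R apply_bcontfun y (discrete i, t)" for i t
  have x_sol: "x i t = sol y i t" if "t \<ge> 0" for i t
  proof -
    have "apply_bcontfun y (discrete i, t) = exp (- K * t) *\<^sub>R sol y i t"
      using that by (subst y[symmetric]) (simp add: TT T_def discrete_inverse)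
    then show ?thesis by (simp add: x_def exp_minus)
  qed
  show thesis
  proof (rule that)
    fix i assume "i \<in> I"
    then show "x i 0 = x0 i" by (simp add: x_sol sol_def X0_def)
  next
    fix i and t :: real assume i: "i \<in> I" and t: "t \<ge> 0"
    have "rhs y i t = G i t (\<lambda>j. x j t)" using i by (simp add: rhs_def x_def H_def)
    then show "(x i has_vector_derivative G i t (\<lambda>j. x j t)) (at t within {0..})"
      using has_vector_derivative_transform[OF _ x_sol sol_deriv[OF t], of i] t by simp
  qed
qed

section \<open>The grounded Laplacian\<close>

text \<open>This is \<open>- H e\<close> for the grounded Laplacian H: the leader has zero error
  against itself, hence the entry 0 at node N + 1.\<close>

definition laplacian_err :: "nat \<Rightarrow> (nat \<times> nat) set \<Rightarrow> (nat \<Rightarrow> 'a::real_vector) \<Rightarrow> nat \<Rightarrow> 'a" where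
  "laplacian_err N Eg e i = (\<Sum>j\<in>nbrs Eg i. (if j = N + 1 then 0 else e j) - e i)"

lemma obs_z_eq_laplacian_err:
  assumes "i \<in> {1..N}"
  shows "obs_z N Eg v vh i t = laplacian_err N Eg (\<lambda>i. vh i t - v t) i"
  using assms unfolding obs_z_def laplacian_err_def by (intro sum.cong) auto

locale observer_graph =
  fixes N :: nat and Eg :: "(nat \<times> nat) set"
  assumes N_pos: "N \<ge> 1"
    and edges: "Eg \<subseteq> {1..N+1} \<times> {1..N}"
    and spanning_tree: "\<forall>i\<in>{1..N}. (N + 1, i) \<in> Eg\<^sup>+"
    and undirected: "\<forall>i\<in>{1..N}. \<forall>j\<in>{1..N}. (i, j) \<in> Eg \<longleftrightarrow> (j, i) \<in> Eg"
begin

abbreviation lap :: "(nat \<Rightarrow> 'a::real_vector) \<Rightarrow> nat \<Rightarrow> 'a" where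
  "lap \<equiv> laplacian_err N Eg"

lemma finite_Eg: "finite Eg"
  using finite_subset[OF edges] by simp

lemma nbrs_subset: "nbrs Eg i \<subseteq> {1..N+1}"
  using edges by (auto simp: nbrs_def)

lemma sum_nbrs: "(\<Sum>i\<in>{1..N}. \<Sum>j\<in>nbrs Eg i. f j i) = (\<Sum>(j, i)\<in>Eg. f j i)"
proof -
  have "finite (nbrs Eg i)" for i using finite_subset[OF nbrs_subset] by simp
  then have "(\<Sum>i\<in>{1..N}. \<Sum>j\<in>nbrs Eg i. f j i) = (\<Sum>(i, j)\<in>(SIGMA i:{1..N}. nbrs Eg i). f j i)"
    by (simp add: sum.Sigma)
  also have "\<dots> = (\<Sum>(j, i)\<in>Eg. f j i)"
    using edges by (intro sum.reindex_bij_witness[of _ prod.swap prod.swap]) (auto simp: nbrs_def)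
  finally show ?thesis .
qed

text \<open>Undirectedness of the follower subgraph enters through this reindexing. Edges leaving
  the leader have no reverse and are masked by zero.\<close>

lemma sum_follower_edges_swap:
  "(\<Sum>(j, i)\<in>Eg. if j = N + 1 then 0 else f j i) = (\<Sum>(j, i)\<in>Eg. if j = N + 1 then 0 else f i j)"
proof -
  define F where "F = {p \<in> Eg. fst p \<noteq> N + 1}"
  have F: "(\<Sum>(j, i)\<in>Eg. if j = N + 1 then 0 else g j i) = (\<Sum>(j, i)\<in>F. g j i)" for g
    unfolding F_def using finite_Eg
    by (simp add: sum.inter_filter case_prod_unfold if_distrib cong: if_cong) (rule sum.cong, auto)
  have sw: "prod.swap p \<in> F" if "p \<in> F" for p
  proof -
    obtain j i where p: "p = (j, i)" by force
    then have "j \<in> {1..N}" "i \<in> {1..N}" "(j, i) \<in> Eg" using that edges by (auto simp: F_def)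
    then show ?thesis using undirected by (auto simp: p F_def)
  qed
  have "(\<Sum>(j, i)\<in>F. f j i) = (\<Sum>(j, i)\<in>F. f i j)"
    by (rule sum.reindex_bij_witness[of _ prod.swap prod.swap]) (use sw in auto)
  then show ?thesis by (simp only: F)
qed

lemma sum_inner_lap:
  fixes a b :: "nat \<Rightarrow> 'a::real_inner"
  shows "(\<Sum>i\<in>{1..N}. a i \<bullet> lap b i)
    = (\<Sum>(j, i)\<in>Eg. if j = N + 1 then 0 else a i \<bullet> b j) - (\<Sum>(j, i)\<in>Eg. a i \<bullet> b i)"
proof -
  have "(\<Sum>i\<in>{1..N}. a i \<bullet> lap b i)
      = (\<Sum>(j, i)\<in>Eg. a i \<bullet> ((if j = N + 1 then 0 else b j) - b i))"
    by (subst sum_nbrs[symmetric]) (simp add: laplacian_err_def inner_sum_right)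
  also have "\<dots> = (\<Sum>(j, i)\<in>Eg. (if j = N + 1 then 0 else a i \<bullet> b j) - a i \<bullet> b i)"
    by (intro sum.cong) (auto simp: inner_diff_right)
  finally show ?thesis by (simp add: sum_subtractf case_prod_unfold)
qed

lemma lap_symmetric:
  fixes a b :: "nat \<Rightarrow> 'a::real_inner"
  shows "(\<Sum>i\<in>{1..N}. a i \<bullet> lap b i) = (\<Sum>i\<in>{1..N}. b i \<bullet> lap a i)"
  unfolding sum_inner_lap
  by (subst sum_follower_edges_swap, intro arg_cong2[where f = "(-)"] sum.cong)
    (auto simp: inner_commute)

text \<open>The two sides differ exactly by the sum of |e_i|^2 over the edges leaving the leader,
  where expanding the square produces one such term instead of two.\<close>

lemma lap_dissipation:
  fixes e :: "nat \<Rightarrow> 'a::real_inner"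
  shows "(\<Sum>(j, i)\<in>Eg. (norm ((if j = N + 1 then 0 else e j) - e i))\<^sup>2) \<le> - 2 * (\<Sum>i\<in>{1..N}. e i \<bullet> lap e i)"
proof -
  have "(\<Sum>(j, i)\<in>Eg. (norm ((if j = N + 1 then 0 else e j) - e i))\<^sup>2)
      = (\<Sum>(j, i)\<in>Eg. (if j = N + 1 then 0 else e j \<bullet> e j) + e i \<bullet> e i - 2 * (if j = N + 1 then 0 else e i \<bullet> e j))"
    by (intro sum.cong) (auto simp: power2_norm_eq_inner inner_diff_left inner_diff_right inner_commute)
  also have "\<dots> = (\<Sum>(j, i)\<in>Eg. if j = N + 1 then 0 else e j \<bullet> e j) + (\<Sum>(j, i)\<in>Eg. e i \<bullet> e i)
      - 2 * (\<Sum>(j, i)\<in>Eg. if j = N + 1 then 0 else e i \<bullet> e j)"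
    by (simp add: sum.distrib sum_subtractf case_prod_unfold sum_distrib_left)
  also have "(\<Sum>(j, i)\<in>Eg. if j = N + 1 then 0 else e j \<bullet> e j) = (\<Sum>(j, i)\<in>Eg. if j = N + 1 then 0 else e i \<bullet> e i)"
    by (rule sum_follower_edges_swap)
  also have "\<dots> \<le> (\<Sum>(j, i)\<in>Eg. e i \<bullet> e i)"
    by (intro sum_mono) auto
  finally show ?thesis unfolding sum_inner_lap by (simp add: case_prod_unfold)
qed

text \<open>A path from the leader, whose error is 0, telescopes: each edge difference is at most
  the root of the edge energy \<open>E e\<close>, so the error at i is at most the path length times
  that root. This turns reachability into positive definiteness.\<close>

lemma lap_coercive:
  obtains C :: real where "C > 0"
    "\<And>(e :: nat \<Rightarrow> 'a::real_inner) i. i \<in> {1..N} \<Longrightarrow> (norm (e i))\<^sup>2 \<le> C * - (\<Sum>i\<in>{1..N}. e i \<bullet> lap e i)"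
proof -
  define E where "E e = (\<Sum>(j, i)\<in>Eg. (norm ((if j = N + 1 then 0 else e j) - e i))\<^sup>2)" for e :: "nat \<Rightarrow> 'a"
  have edge: "norm ((if j = N + 1 then 0 else e j) - e i) \<le> sqrt (E e)" if "(j, i) \<in> Eg" for e j i
  proof (rule real_le_rsqrt)
    show "(norm ((if j = N + 1 then 0 else e j) - e i))\<^sup>2 \<le> E e"
      unfolding E_def using member_le_sum[OF that, of "\<lambda>(j, i). (norm ((if j = N + 1 then 0 else e j) - e i))\<^sup>2"]
        finite_Eg by auto
  qed
  have "i \<noteq> N + 1 \<and> (\<exists>c\<ge>0. \<forall>e. norm (e i) \<le> c * sqrt (E e))" if "(N + 1, i) \<in> Eg\<^sup>+" for i
    using that
  proof (induction rule: trancl_induct)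
    case (base i)
    then have "norm (e i) \<le> 1 * sqrt (E e)" for e using edge[OF base, of e] by simp
    then show ?case using edges base by (metis SigmaD2 Suc_eq_plus1 atLeastAtMost_iff not_less_eq_eq order_refl subsetD zero_le_one)
  next
    case (step j i)
    then obtain c where c: "c \<ge> 0" "\<And>e. norm (e j) \<le> c * sqrt (E e)" "j \<noteq> N + 1" by blast
    have "norm (e i) \<le> (c + 1) * sqrt (E e)" for e
      using edge[OF step(2), of e] c(2)[of e] c(3) norm_triangle_ineq4[of "e j" "e j - e i"]
      by (simp add: algebra_simps)
    moreover have "i \<noteq> N + 1" using edges step(2) by auto
    ultimately show ?case using c(1) by (metis add_nonneg_nonneg zero_le_one)
  qed
  then have "\<forall>i\<in>{1..N}. \<exists>c\<ge>0. \<forall>e. norm (e i) \<le> c * sqrt (E e)" using spanning_tree by blast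
  then obtain c where c: "\<And>i. i \<in> {1..N} \<Longrightarrow> c i \<ge> 0"
    "\<And>i e. i \<in> {1..N} \<Longrightarrow> norm (e i) \<le> c i * sqrt (E e)" by metis
  define C where "C = 2 * (\<Sum>i\<in>{1..N}. (c i)\<^sup>2) + 1"
  show thesis
  proof
    show "C > 0" unfolding C_def by (simp add: sum_nonneg add_nonneg_pos)
    fix e :: "nat \<Rightarrow> 'a" and i assume i: "i \<in> {1..N}"
    have E0: "E e \<ge> 0" unfolding E_def by (intro sum_nonneg) auto
    have "(norm (e i))\<^sup>2 \<le> (c i * sqrt (E e))\<^sup>2" using c(2)[OF i] by (intro power_mono) auto
    also have "\<dots> = (c i)\<^sup>2 * E e" using E0 by (simp add: power_mult_distrib)
    also have "\<dots> \<le> (C / 2) * E e"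
      using E0 member_le_sum[OF i, of "\<lambda>i. (c i)\<^sup>2"] unfolding C_def by (intro mult_right_mono) auto
    also have "\<dots> \<le> (C / 2) * (- 2 * (\<Sum>i\<in>{1..N}. e i \<bullet> lap e i))"
      using lap_dissipation[of e] \<open>C > 0\<close> unfolding E_def by (intro mult_left_mono) auto
    finally show "(norm (e i))\<^sup>2 \<le> C * - (\<Sum>i\<in>{1..N}. e i \<bullet> lap e i)" by simp
  qed
qed

text \<open>Coercivity at the index k of the largest error and Cauchy-Schwarz give |e_k|^2 \<le> C N
  |e_k| |z_j| with z_j the largest; one factor |e_k| cancels. Having one \<open>j\<close> for all
  \<open>i\<close> lets the gain at a single follower pay for every error.\<close>

lemma lap_bounded_below:
  obtains C :: real where "C > 0"
    "\<And>e :: nat \<Rightarrow> 'a::real_inner. \<exists>j\<in>{1..N}. \<forall>i\<in>{1..N}. norm (e i) \<le> C * norm (lap e j)"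
proof -
  obtain C where C: "C > 0" "\<And>(e :: nat \<Rightarrow> 'a) i. i \<in> {1..N} \<Longrightarrow> (norm (e i))\<^sup>2 \<le> C * - (\<Sum>i\<in>{1..N}. e i \<bullet> lap e i)"
    using lap_coercive by blast
  have attained: "\<exists>j\<in>{1..N}. \<forall>i\<in>{1..N}. f i \<le> f j" for f :: "nat \<Rightarrow> real"
  proof -
    have "Max (f ` {1..N}) \<in> f ` {1..N}" using N_pos by (intro Max_in) auto
    then obtain j where "j \<in> {1..N}" "Max (f ` {1..N}) = f j" by auto
    then show ?thesis by (metis Max_ge finite_atLeastAtMost finite_imageI imageI)
  qed
  show thesis
  proof
    show "C * real N > 0" using C N_pos by simp
    fix e :: "nat \<Rightarrow> 'a"
    obtain j where j: "j \<in> {1..N}" "\<And>i. i \<in> {1..N} \<Longrightarrow> norm (lap e i) \<le> norm (lap e j)"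
      using attained[of "\<lambda>i. norm (lap e i)"] by blast
    obtain k where k: "k \<in> {1..N}" "\<And>i. i \<in> {1..N} \<Longrightarrow> norm (e i) \<le> norm (e k)"
      using attained[of "\<lambda>i. norm (e i)"] by blast
    have "- (\<Sum>i\<in>{1..N}. e i \<bullet> lap e i) = (\<Sum>i\<in>{1..N}. - (e i \<bullet> lap e i))" by (simp add: sum_negf)
    also have "\<dots> \<le> (\<Sum>i\<in>{1..N}. norm (e k) * norm (lap e j))"
    proof (rule sum_mono)
      fix i assume i: "i \<in> {1..N}"
      have "- (e i \<bullet> lap e i) \<le> norm (e i) * norm (lap e i)"
        using norm_cauchy_schwarz[of "- e i" "lap e i"] by simp
      also have "\<dots> \<le> norm (e k) * norm (lap e j)" using j(2)[OF i] k(2)[OF i] by (intro mult_mono) auto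
      finally show "- (e i \<bullet> lap e i) \<le> norm (e k) * norm (lap e j)" .
    qed
    also have "\<dots> = real N * (norm (e k) * norm (lap e j))" by simp
    finally have "C * - (\<Sum>i\<in>{1..N}. e i \<bullet> lap e i) \<le> C * (real N * (norm (e k) * norm (lap e j)))"
      using C by (intro mult_left_mono) auto
    then have "norm (e k) * norm (e k) \<le> norm (e k) * (C * real N * norm (lap e j))"
      using C(2)[OF k(1), of e] by (simp add: power2_eq_square mult_ac)
    then have "norm (e k) \<le> C * real N * norm (lap e j)"
      using C(1) by (cases "norm (e k) = 0") auto
    then show "\<exists>j\<in>{1..N}. \<forall>i\<in>{1..N}. norm (e i) \<le> C * real N * norm (lap e j)"
      using j(1) k(2) order_trans by blast
  qed
qed

end

lemma (in observer_graph) has_vector_derivative_lap: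
  fixes e :: "real \<Rightarrow> nat \<Rightarrow> 'a::real_normed_vector"
  assumes e: "\<And>i. i \<in> {1..N} \<Longrightarrow> ((\<lambda>s. e s i) has_vector_derivative e' i) (at t within T)"
    and i: "i \<in> {1..N}"
  shows "((\<lambda>s. lap (e s) i) has_vector_derivative lap e' i) (at t within T)"
  unfolding laplacian_err_def
proof (intro has_vector_derivative_sum has_vector_derivative_diff)
  fix j assume "j \<in> nbrs Eg i"
  then have "j = N + 1 \<or> j \<in> {1..N}" using nbrs_subset[of i] by fastforce
  then show "((\<lambda>s. if j = N + 1 then 0 else e s j) has_vector_derivative (if j = N + 1 then 0 else e' j)) (at t within T)"
    using e by auto
qed (rule e[OF i])

section \<open>The Lyapunov function\<close>

text \<open>The observer equations at a single time, so that the Lyapunov argument applies to functions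
  that solve them only on an initial interval.\<close>

definition observer_at ::
  "(real^'m \<Rightarrow> real^'l^'m) \<Rightarrow> nat \<Rightarrow> (nat \<times> nat) set \<Rightarrow> real \<Rightarrow> (real^'m \<Rightarrow> real)
    \<Rightarrow> (real \<Rightarrow> real^'m) \<Rightarrow> (nat \<Rightarrow> real \<Rightarrow> real^'m) \<Rightarrow> (nat \<Rightarrow> real \<Rightarrow> real^'l)
    \<Rightarrow> (nat \<Rightarrow> real \<Rightarrow> real) \<Rightarrow> real \<Rightarrow> bool" where
  "observer_at phi N Eg \<mu> \<rho> v vh wh kh t \<longleftrightarrow>
     (\<forall>i\<in>{1..N}. let z = laplacian_err N Eg (\<lambda>i. vh i t - v t) i in
        (vh i has_vector_derivative (phi (vh i t) *v wh i t + (kh i t * \<rho> z) *\<^sub>R z)) (at t within {0..}) \<and>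
        (wh i has_vector_derivative (\<mu> *\<^sub>R (transpose (phi (vh i t)) *v z))) (at t within {0..}) \<and>
        (kh i has_vector_derivative (\<rho> z * (z \<bullet> z))) (at t within {0..}))"

lemma observer_solution_iff_observer_at:
  "observer_solution phi N Eg \<mu> (\<lambda>_. \<rho>) v vh wh kh \<longleftrightarrow> (\<forall>t\<ge>0. observer_at phi N Eg \<mu> \<rho> v vh wh kh t)"
  unfolding observer_solution_def observer_at_def Let_def has_real_derivative_iff_has_vector_derivative
  using obs_z_eq_laplacian_err[of _ N Eg v vh] by auto

text \<open>The minus sign compensates that \<open>laplacian_err\<close> is \<open>- H e\<close>.
  The weight 1/(2 \<mu>) cancels the adaptation rate. Writing \<open>scaleR\<close> and real inner
  products lets the bounded linear and bilinear derivative rules apply throughout.\<close>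

definition lyapunov ::
  "nat \<Rightarrow> (nat \<times> nat) set \<Rightarrow> real \<Rightarrow> real^'l \<Rightarrow> real \<Rightarrow> (nat \<Rightarrow> real^'m) \<Rightarrow> (nat \<Rightarrow> real^'l) \<Rightarrow> (nat \<Rightarrow> real) \<Rightarrow> real"
  where "lyapunov N Eg \<mu> \<omega> \<kappa> e w k =
    - (1/2) *\<^sub>R (\<Sum>i\<in>{1..N}. e i \<bullet> laplacian_err N Eg e i)
    + (1 / (2 * \<mu>)) *\<^sub>R (\<Sum>i\<in>{1..N}. (w i - \<omega>) \<bullet> (w i - \<omega>)) + (1/2) *\<^sub>R (\<Sum>i\<in>{1..N}. (k i - \<kappa>) \<bullet> (k i - \<kappa>))"

context observer_graph
begin

text \<open>The adaptation laws are made to cancel: \<omega> takes the place of \<open>wh\<close>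
  and \<kappa> that of \<open>kh\<close>, so the derivative depends on the observer state through
  \<open>vh\<close> alone.\<close>

lemma lyapunov_has_vector_derivative:
  fixes phi :: "real^'m \<Rightarrow> real^'l^'m" and v :: "real \<Rightarrow> real^'m"
  assumes \<mu>: "\<mu> > 0"
    and v': "(v has_vector_derivative phi (v t) *v \<omega>) (at t within {0..})"
    and obs: "observer_at phi N Eg \<mu> \<rho> v vh wh kh t"
  defines "z \<equiv> lap (\<lambda>i. vh i t - v t)"
  shows "((\<lambda>s. lyapunov N Eg \<mu> \<omega> \<kappa> (\<lambda>i. vh i s - v s) (\<lambda>i. wh i s) (\<lambda>i. kh i s)) has_vector_derivative
    (\<Sum>i\<in>{1..N}. - (z i \<bullet> (phi (vh i t) *v \<omega> - phi (v t) *v \<omega>)) - \<kappa> * (\<rho> (z i) * (z i \<bullet> z i)))) (at t within {0..})"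
proof -
  define e where "e s i = vh i s - v s" for s i
  define e' where "e' i = phi (vh i t) *v wh i t + (kh i t * \<rho> (z i)) *\<^sub>R z i - phi (v t) *v \<omega>" for i
  define w' where "w' i = \<mu> *\<^sub>R (transpose (phi (vh i t)) *v z i)" for i
  define k' where "k' i = \<rho> (z i) * (z i \<bullet> z i)" for i
  have "e t = (\<lambda>i. vh i t - v t)" by (auto simp: e_def)
  then have z: "z = lap (e t)" by (simp add: z_def)
  have vh: "((\<lambda>s. e s i) has_vector_derivative e' i) (at t within {0..})"
    and wh: "((\<lambda>s. wh i s - \<omega>) has_vector_derivative w' i) (at t within {0..})"
    and kh: "((\<lambda>s. kh i s - \<kappa>) has_vector_derivative k' i) (at t within {0..})" if "i \<in> {1..N}" for i
    using obs that v'
    by (auto simp: observer_at_def Let_def e_def e'_def w'_def k'_def z_def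
        intro!: derivative_eq_intros)
  have 1: "((\<lambda>s. \<Sum>i\<in>{1..N}. e s i \<bullet> lap (e s) i) has_vector_derivative
      (\<Sum>i\<in>{1..N}. e t i \<bullet> lap e' i + e' i \<bullet> lap (e t) i)) (at t within {0..})"
    by (intro has_vector_derivative_sum bounded_bilinear.has_vector_derivative[OF bounded_bilinear_inner]
        has_vector_derivative_lap vh)
  have 2: "((\<lambda>s. \<Sum>i\<in>{1..N}. (wh i s - \<omega>) \<bullet> (wh i s - \<omega>)) has_vector_derivative
      (\<Sum>i\<in>{1..N}. (wh i t - \<omega>) \<bullet> w' i + w' i \<bullet> (wh i t - \<omega>))) (at t within {0..})"
    by (intro has_vector_derivative_sum bounded_bilinear.has_vector_derivative[OF bounded_bilinear_inner] wh)
  have 3: "((\<lambda>s. \<Sum>i\<in>{1..N}. (kh i s - \<kappa>) \<bullet> (kh i s - \<kappa>)) has_vector_derivative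
      (\<Sum>i\<in>{1..N}. (kh i t - \<kappa>) \<bullet> k' i + k' i \<bullet> (kh i t - \<kappa>))) (at t within {0..})"
    by (intro has_vector_derivative_sum bounded_bilinear.has_vector_derivative[OF bounded_bilinear_inner] kh)
  \<comment> \<open>Symmetry of the Laplacian merges the two halves of the product rule;
    \<open>adj\<close> then moves \<open>phi\<close> across the inner product so that the update of
    \<open>wh\<close> pairs with the same \<open>z\<close>.\<close>
  have sym: "(\<Sum>i\<in>{1..N}. e t i \<bullet> lap e' i + e' i \<bullet> lap (e t) i) = 2 * (\<Sum>i\<in>{1..N}. e' i \<bullet> z i)"
    using lap_symmetric[of "e t" e'] by (simp add: sum.distrib z)
  have adj: "(wh i t - \<omega>) \<bullet> w' i = \<mu> * ((phi (vh i t) *v (wh i t - \<omega>)) \<bullet> z i)" for i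
    by (simp add: w'_def transpose_matrix_vector dot_lmul_matrix inner_commute[of "wh i t - \<omega>"]
        inner_commute[of "z i"])
  have eq: "- (1/2) *\<^sub>R (\<Sum>i\<in>{1..N}. e t i \<bullet> lap e' i + e' i \<bullet> lap (e t) i)
      + (1 / (2 * \<mu>)) *\<^sub>R (\<Sum>i\<in>{1..N}. (wh i t - \<omega>) \<bullet> w' i + w' i \<bullet> (wh i t - \<omega>))
      + (1/2) *\<^sub>R (\<Sum>i\<in>{1..N}. (kh i t - \<kappa>) \<bullet> k' i + k' i \<bullet> (kh i t - \<kappa>))
    = (\<Sum>i\<in>{1..N}. - (z i \<bullet> (phi (vh i t) *v \<omega> - phi (v t) *v \<omega>)) - \<kappa> * (\<rho> (z i) * (z i \<bullet> z i)))"
    (is "?L = ?R")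
  proof -
    have "?L = (\<Sum>i\<in>{1..N}. - (e' i \<bullet> z i) + (phi (vh i t) *v (wh i t - \<omega>)) \<bullet> z i + (kh i t - \<kappa>) * k' i)"
    proof -
      have w: "(1 / (2 * \<mu>)) *\<^sub>R (\<Sum>i\<in>{1..N}. (wh i t - \<omega>) \<bullet> w' i + w' i \<bullet> (wh i t - \<omega>))
          = (\<Sum>i\<in>{1..N}. (phi (vh i t) *v (wh i t - \<omega>)) \<bullet> z i)"
        using \<mu> by (simp add: inner_commute[of "w' _"] adj sum_distrib_left)
      have k: "(1/2) *\<^sub>R (\<Sum>i\<in>{1..N}. (kh i t - \<kappa>) \<bullet> k' i + k' i \<bullet> (kh i t - \<kappa>))
          = (\<Sum>i\<in>{1..N}. (kh i t - \<kappa>) * k' i)"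
        by (simp add: sum_distrib_left algebra_simps)
      show ?thesis unfolding sym w k by (simp add: sum.distrib sum_negf sum_subtractf)
    qed
    also have "\<dots> = ?R"
      by (intro sum.cong) (auto simp: e'_def k'_def inner_diff_left inner_add_left inner_diff_right
          matrix_vector_mult_diff_distrib inner_commute algebra_simps)
    finally show ?thesis .
  qed
  show ?thesis
    unfolding lyapunov_def e_def[symmetric] eq[symmetric]
    by (rule has_vector_derivative_add[OF has_vector_derivative_add
          [OF bounded_linear.has_vector_derivative[OF bounded_linear_scaleR_right 1]
              bounded_linear.has_vector_derivative[OF bounded_linear_scaleR_right 2]]
          bounded_linear.has_vector_derivative[OF bounded_linear_scaleR_right 3]])
qed

text \<open>By Young's inequality the mismatch \<delta> at follower i costs |z_i|^2 / 2 +
  |\<delta>|^2 / 2. If z_j controls all errors and |z_j| \<le> n, every \<open>vh i\<close> lies in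
  the ball of radius R + C n, and \<rho>(z_j) dominates the squared Lipschitz constant on that
  ball.\<close>

lemma ex_gain:
  fixes phi :: "real^'m \<Rightarrow> real^'l^'m" and \<omega> :: "real^'l"
  assumes phi: "smooth_fun phi"
  obtains \<rho> :: "real^'m \<Rightarrow> real" and \<kappa> :: real where "smooth_fun \<rho>" "\<And>x. \<rho> x \<ge> 1"
    "\<And>(vh :: nat \<Rightarrow> real^'m) u. norm u \<le> R \<Longrightarrow>
      (\<Sum>i\<in>{1..N}. - (lap (\<lambda>i. vh i - u) i \<bullet> (phi (vh i) *v \<omega> - phi u *v \<omega>))
        - \<kappa> * (\<rho> (lap (\<lambda>i. vh i - u) i) * (lap (\<lambda>i. vh i - u) i \<bullet> lap (\<lambda>i. vh i - u) i))) \<le> 0"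
proof -
  obtain C where C: "C > 0"
    "\<And>e :: nat \<Rightarrow> real^'m. \<exists>j\<in>{1..N}. \<forall>i\<in>{1..N}. norm (e i) \<le> C * norm (lap e j)"
    using lap_bounded_below by blast
  obtain K where K: "K \<ge> 0" "\<And>(A :: real^'l^'m) x. norm (A *v x) \<le> norm A * norm x * K"
    using bounded_bilinear.nonneg_bounded[OF bounded_bilinear_matrix_vector_mult] by blast
  have "\<exists>L\<ge>0. \<forall>x y. norm x \<le> R + C * real n \<longrightarrow> norm y \<le> R + C * real n \<longrightarrow>
      norm (phi x *v \<omega> - phi y *v \<omega>) \<le> L * norm (x - y)" for n
  proof -
    obtain L where L: "L \<ge> 0" "\<And>x y. norm x \<le> R + C * real n \<Longrightarrow> norm y \<le> R + C * real n \<Longrightarrow>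
        norm (phi x - phi y) \<le> L * norm (x - y)"
      using smooth_fun_lipschitz_on_cball[OF phi] by blast
    have "norm (phi x *v \<omega> - phi y *v \<omega>) \<le> (L * norm \<omega> * K) * norm (x - y)"
      if "norm x \<le> R + C * real n" "norm y \<le> R + C * real n" for x y
    proof -
      have "norm ((phi x - phi y) *v \<omega>) \<le> norm (phi x - phi y) * norm \<omega> * K" by (rule K)
      also have "\<dots> \<le> (L * norm (x - y)) * norm \<omega> * K"
        using L(2)[OF that] K(1) by (intro mult_right_mono) auto
      finally show ?thesis by (simp add: matrix_vector_mult_diff_rdistrib mult_ac)
    qed
    moreover have "L * norm \<omega> * K \<ge> 0" using L K by simp
    ultimately show ?thesis by blast
  qed
  then obtain L where L: "\<And>n. L n \<ge> 0" "\<And>n x y. norm x \<le> R + C * real n \<Longrightarrow> norm y \<le> R + C * real n \<Longrightarrow>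
      norm (phi x *v \<omega> - phi y *v \<omega>) \<le> L n * norm (x - y)" by metis
  obtain \<rho> :: "real^'m \<Rightarrow> real" where \<rho>: "smooth_fun \<rho>" "\<And>x. \<rho> x \<ge> 1"
    "\<And>x. \<exists>n. norm x \<le> real n \<and> (L n)\<^sup>2 \<le> \<rho> x"
    using ex_smooth_majorant[of "\<lambda>n. (L n)\<^sup>2"] by blast
  \<comment> \<open>The first 1/2 absorbs each follower's own Young term; the rest absorbs N
    mismatch terms, all charged to \<open>q j\<close>, with C^2 from bounding the errors by
    z_j.\<close>
  define \<kappa> where "\<kappa> = 1/2 + real N * C\<^sup>2 / 2"
  show thesis
  proof (rule that[OF \<rho>(1,2)])
    fix vh :: "nat \<Rightarrow> real^'m" and u :: "real^'m" assume u: "norm u \<le> R"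
    define e where "e i = vh i - u" for i
    define q where "q i = \<rho> (lap e i) * (lap e i \<bullet> lap e i)" for i
    have q0: "q i \<ge> 0" "lap e i \<bullet> lap e i \<le> q i" for i
      using \<rho>(2)[of "lap e i"] mult_right_mono[OF \<rho>(2)[of "lap e i"], of "lap e i \<bullet> lap e i"]
      unfolding q_def by auto
    obtain j where j: "j \<in> {1..N}" "\<And>i. i \<in> {1..N} \<Longrightarrow> norm (e i) \<le> C * norm (lap e j)"
      using C(2)[of e] by blast
    obtain n where n: "norm (lap e j) \<le> real n" "(L n)\<^sup>2 \<le> \<rho> (lap e j)" using \<rho>(3) by blast
    have \<Delta>: "- (lap e i \<bullet> (phi (vh i) *v \<omega> - phi u *v \<omega>)) \<le> q i / 2 + C\<^sup>2 * q j / 2"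
      if i: "i \<in> {1..N}" for i
    proof -
      define \<delta> where "\<delta> = phi (vh i) *v \<omega> - phi u *v \<omega>"
      have Cn: "C * norm (lap e j) \<le> C * real n" using n C by (intro mult_left_mono) auto
      have "norm (vh i) \<le> norm u + norm (e i)" using norm_triangle_ineq[of u "e i"] by (simp add: e_def)
      then have "norm (vh i) \<le> R + C * real n" "norm u \<le> R + C * real n"
        using u j(2)[OF i] Cn mult_nonneg_nonneg[of C "real n"] C(1) by linarith+
      then have "norm \<delta> \<le> L n * norm (e i)" unfolding \<delta>_def e_def by (rule L)
      also have "\<dots> \<le> L n * (C * norm (lap e j))" using j(2)[OF i] L(1) by (intro mult_left_mono)
      finally have "(norm \<delta>)\<^sup>2 \<le> (L n * (C * norm (lap e j)))\<^sup>2" by (intro power_mono) auto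
      also have "\<dots> = C\<^sup>2 * ((L n)\<^sup>2 * (lap e j \<bullet> lap e j))"
        by (simp add: power_mult_distrib power2_norm_eq_inner)
      also have "\<dots> \<le> C\<^sup>2 * q j"
        unfolding q_def using n(2) by (intro mult_left_mono mult_right_mono) auto
      finally have \<delta>: "(norm \<delta>)\<^sup>2 \<le> C\<^sup>2 * q j" .
      have "- (lap e i \<bullet> \<delta>) \<le> norm (lap e i) * norm \<delta>"
        using norm_cauchy_schwarz[of "- lap e i" \<delta>] by simp
      also have "\<dots> \<le> (norm (lap e i))\<^sup>2 / 2 + (norm \<delta>)\<^sup>2 / 2"
        using sum_squares_bound[of "norm (lap e i)" "norm \<delta>"] by simp
      finally show ?thesis using \<delta> q0(2)[of i] unfolding \<delta>_def power2_norm_eq_inner by linarith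
    qed
    have "(\<Sum>i\<in>{1..N}. - (lap e i \<bullet> (phi (vh i) *v \<omega> - phi u *v \<omega>)))
        \<le> (\<Sum>i\<in>{1..N}. q i / 2 + C\<^sup>2 * q j / 2)" using \<Delta> by (rule sum_mono)
    also have "\<dots> = (\<Sum>i\<in>{1..N}. q i) / 2 + real N * (C\<^sup>2 * q j) / 2"
      by (simp add: sum.distrib sum_divide_distrib)
    also have "\<dots> \<le> (\<Sum>i\<in>{1..N}. q i) / 2 + real N * (C\<^sup>2 * (\<Sum>i\<in>{1..N}. q i)) / 2"
      using member_le_sum[OF j(1), of q] q0 by (intro add_left_mono divide_right_mono mult_left_mono) auto
    also have "\<dots> = \<kappa> * (\<Sum>i\<in>{1..N}. q i)" by (simp add: \<kappa>_def algebra_simps)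
    finally show "(\<Sum>i\<in>{1..N}. - (lap (\<lambda>i. vh i - u) i \<bullet> (phi (vh i) *v \<omega> - phi u *v \<omega>))
        - \<kappa> * (\<rho> (lap (\<lambda>i. vh i - u) i) * (lap (\<lambda>i. vh i - u) i \<bullet> lap (\<lambda>i. vh i - u) i))) \<le> 0"
      unfolding e_def[symmetric] q_def[symmetric] by (simp add: sum_subtractf sum_distrib_left)
  qed
qed

end

section \<open>Coercivity of the Lyapunov function\<close>

context observer_graph
begin

lemma lap_cong:
  assumes "\<And>j. j \<in> {1..N} \<Longrightarrow> e j = e' j" and "i \<in> {1..N}"
  shows "lap e i = lap e' i"
  unfolding laplacian_err_def
proof (rule sum.cong[OF refl])
  fix j assume "j \<in> nbrs Eg i"
  then have "j = N + 1 \<or> j \<in> {1..N}" using nbrs_subset[of i] by fastforce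
  then show "(if j = N + 1 then 0 else e j) - e i = (if j = N + 1 then 0 else e' j) - e' i"
    using assms by auto
qed

lemma lyapunov_cong:
  assumes "\<And>j. j \<in> {1..N} \<Longrightarrow> e j = e' j" "\<And>j. j \<in> {1..N} \<Longrightarrow> w j = w' j"
    "\<And>j. j \<in> {1..N} \<Longrightarrow> k j = k' j"
  shows "lyapunov N Eg \<mu> \<omega> \<kappa> e w k = lyapunov N Eg \<mu> \<omega> \<kappa> e' w' k'"
proof -
  have "lap e i = lap e' i" if "i \<in> {1..N}" for i using assms(1) that by (rule lap_cong)
  then show ?thesis unfolding lyapunov_def using assms by (intro arg_cong2[where f = "(+)"] arg_cong2[where f = scaleR] sum.cong) auto
qed

text \<open>All three parts are nonnegative, so each is bounded by the total. \<open>C\<close>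
  precedes \<mu>, \<omega> and \<kappa> because it stems from the Laplacian alone.\<close>

lemma lyapunov_bounds:
  obtains C where "C > 0"
    "\<And>\<mu> \<omega> \<kappa> (e :: nat \<Rightarrow> real^'m) (w :: nat \<Rightarrow> real^'l) k i. \<mu> > 0 \<Longrightarrow> i \<in> {1..N} \<Longrightarrow>
      (norm (e i))\<^sup>2 \<le> C * lyapunov N Eg \<mu> \<omega> \<kappa> e w k \<and>
      (norm (w i - \<omega>))\<^sup>2 \<le> 2 * \<mu> * lyapunov N Eg \<mu> \<omega> \<kappa> e w k \<and>
      (norm (k i - \<kappa>))\<^sup>2 \<le> 2 * lyapunov N Eg \<mu> \<omega> \<kappa> e w k"
proof -
  obtain C where C: "C > 0"
    "\<And>(e :: nat \<Rightarrow> real^'m) i. i \<in> {1..N} \<Longrightarrow> (norm (e i))\<^sup>2 \<le> C * - (\<Sum>i\<in>{1..N}. e i \<bullet> lap e i)"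
    using lap_coercive by blast
  show thesis
  proof (rule that[of "2 * C"])
    fix \<mu> \<kappa> :: real and \<omega> and e :: "nat \<Rightarrow> real^'m" and w :: "nat \<Rightarrow> real^'l" and k i
    assume \<mu>: "\<mu> > 0" and i: "i \<in> {1..N}"
    define a where "a = - (\<Sum>i\<in>{1..N}. e i \<bullet> lap e i)"
    define b where "b = (\<Sum>i\<in>{1..N}. (w i - \<omega>) \<bullet> (w i - \<omega>))"
    define c where "c = (\<Sum>i\<in>{1..N}. (k i - \<kappa>) \<bullet> (k i - \<kappa>))"
    define V where "V = lyapunov N Eg \<mu> \<omega> \<kappa> e w k"
    have V: "V = a / 2 + b / (2 * \<mu>) + c / 2"
      by (simp add: V_def lyapunov_def a_def b_def c_def)
    have "0 \<le> (\<Sum>(j, i)\<in>Eg. (norm ((if j = N + 1 then 0 else e j) - e i))\<^sup>2)" by (intro sum_nonneg) auto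
    then have "0 \<le> a" using lap_dissipation[of e] unfolding a_def by linarith
    moreover have "0 \<le> b" "0 \<le> c" unfolding b_def c_def by (intro sum_nonneg; simp)+
    ultimately have V_ge: "a \<le> 2 * V" "b / (2 * \<mu>) \<le> V" "c \<le> 2 * V" using \<mu> by (auto simp: V)
    have "(norm (e i))\<^sup>2 \<le> C * a" using C(2)[OF i] by (simp add: a_def)
    also have "\<dots> \<le> C * (2 * V)" using C(1) V_ge by (intro mult_left_mono) auto
    finally have "(norm (e i))\<^sup>2 \<le> 2 * C * V" by simp
    moreover have "(norm (w i - \<omega>))\<^sup>2 \<le> b"
      unfolding b_def power2_norm_eq_inner by (rule member_le_sum[OF i]) auto
    then have "(norm (w i - \<omega>))\<^sup>2 \<le> 2 * \<mu> * V" using V_ge(2) \<mu> by (simp add: field_simps)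
    moreover have "(norm (k i - \<kappa>))\<^sup>2 \<le> c"
      unfolding c_def power2_norm_eq_inner by (rule member_le_sum[OF i]) auto
    ultimately show "(norm (e i))\<^sup>2 \<le> 2 * C * lyapunov N Eg \<mu> \<omega> \<kappa> e w k \<and>
        (norm (w i - \<omega>))\<^sup>2 \<le> 2 * \<mu> * lyapunov N Eg \<mu> \<omega> \<kappa> e w k \<and>
        (norm (k i - \<kappa>))\<^sup>2 \<le> 2 * lyapunov N Eg \<mu> \<omega> \<kappa> e w k"
      using V_ge unfolding V_def by linarith
  qed (use C in simp)
qed

lemma continuous_on_lap:
  fixes e :: "real \<Rightarrow> nat \<Rightarrow> 'a::real_normed_vector"
  assumes e: "\<And>j. j \<in> {1..N} \<Longrightarrow> continuous_on T (\<lambda>s. e s j)" and i: "i \<in> {1..N}"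
  shows "continuous_on T (\<lambda>s. lap (e s) i)"
  unfolding laplacian_err_def
proof (intro continuous_on_sum continuous_on_diff)
  fix j assume "j \<in> nbrs Eg i"
  then have "j = N + 1 \<or> j \<in> {1..N}" using nbrs_subset[of i] by fastforce
  then show "continuous_on T (\<lambda>s. if j = N + 1 then 0 else e s j)" using e by auto
qed (rule e[OF i])

end

text \<open>\<open>gain\<close> concerns arbitrary points \<open>vh\<close> and \<open>u\<close>
  rather than trajectories, so it applies at each instant of any solution as long as
  \<open>Rv\<close> bounds the leader.\<close>

locale gained_observer = observer_graph N Eg for N Eg +
  fixes phi :: "real^'m \<Rightarrow> real^'l^'m" and \<omega> :: "real^'l" and \<rho> :: "real^'m \<Rightarrow> real"
    and \<kappa> \<mu> Rv :: real and v :: "real \<Rightarrow> real^'m"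
  assumes phi: "smooth_fun phi" and \<rho>: "smooth_fun \<rho>" and \<rho>_ge_1: "\<And>x. \<rho> x \<ge> 1"
    and \<mu>: "\<mu> > 0"
    and gain: "\<And>(vh :: nat \<Rightarrow> real^'m) u. norm u \<le> Rv \<Longrightarrow>
      (\<Sum>i\<in>{1..N}. - (lap (\<lambda>i. vh i - u) i \<bullet> (phi (vh i) *v \<omega> - phi u *v \<omega>))
        - \<kappa> * (\<rho> (lap (\<lambda>i. vh i - u) i) * (lap (\<lambda>i. vh i - u) i \<bullet> lap (\<lambda>i. vh i - u) i))) \<le> 0"
    and leader: "leader_solution phi \<omega> v"
    and v_bound: "\<And>t. t \<ge> 0 \<Longrightarrow> norm (v t) \<le> Rv"
begin

abbreviation "obs_at \<equiv> observer_at phi N Eg \<mu> \<rho> v"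

lemma v_deriv: "t \<ge> 0 \<Longrightarrow> (v has_vector_derivative phi (v t) *v \<omega>) (at t within {0..})"
  using leader by (simp add: leader_solution_def)

lemma v_cont: "continuous_on {0..} v"
  by (rule continuous_on_vector_derivative) (use v_deriv in auto)

text \<open>The equations are asked for only on the open interval, with continuity up to the ends:
  this is what an exit-time argument can supply.\<close>

lemma lyapunov_nonincreasing:
  assumes T: "T \<ge> 0"
    and cont: "\<And>i. i \<in> {1..N} \<Longrightarrow> continuous_on {0..T} (vh i)" "\<And>i. i \<in> {1..N} \<Longrightarrow> continuous_on {0..T} (wh i)"
      "\<And>i. i \<in> {1..N} \<Longrightarrow> continuous_on {0..T} (kh i)"
    and obs: "\<And>t. 0 < t \<Longrightarrow> t < T \<Longrightarrow> obs_at vh wh kh t"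
  defines "V \<equiv> \<lambda>s. lyapunov N Eg \<mu> \<omega> \<kappa> (\<lambda>i. vh i s - v s) (\<lambda>i. wh i s) (\<lambda>i. kh i s)"
  shows "V T \<le> V 0"
proof (rule DERIV_nonpos_imp_decreasing_open[OF T])
  fix t assume t: "0 < t" "t < T"
  have "\<exists>y. (V has_vector_derivative y) (at t within {0..}) \<and> y \<le> 0"
    unfolding V_def
    using lyapunov_has_vector_derivative[OF \<mu> v_deriv obs[OF t], of \<kappa>] gain[OF v_bound, of t "\<lambda>i. vh i t"] t
    by auto
  moreover have "at t within {0..} = at t" using t by (intro at_within_interior) auto
  ultimately show "\<exists>y. DERIV V t :> y \<and> y \<le> 0"
    by (auto simp: has_real_derivative_iff_has_vector_derivative)
next
  have "continuous_on {0..T} v" using v_cont by (rule continuous_on_subset) auto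
  then show "continuous_on {0..T} V"
    unfolding V_def lyapunov_def
    by (intro continuous_on_add continuous_on_scaleR continuous_on_const continuous_on_sum
        continuous_on_inner continuous_on_lap continuous_on_diff cont)
qed

text \<open>\<open>R\<close> depends on the initial data but not on \<open>T\<close> or the
  solution, and the bound is strict; truncation at \<open>R\<close> followed by a first-exit
  argument relies on both.\<close>

lemma observer_bound:
  obtains R where "R > 0"
    "\<And>vh wh kh T i. T \<ge> 0 \<Longrightarrow>
      (\<And>i. i \<in> {1..N} \<Longrightarrow> vh i 0 = v0 i \<and> wh i 0 = w0 i \<and> kh i 0 = k0 i) \<Longrightarrow>
      (\<And>i. i \<in> {1..N} \<Longrightarrow> continuous_on {0..T} (vh i)) \<Longrightarrow>
      (\<And>i. i \<in> {1..N} \<Longrightarrow> continuous_on {0..T} (wh i)) \<Longrightarrow>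
      (\<And>i. i \<in> {1..N} \<Longrightarrow> continuous_on {0..T} (kh i)) \<Longrightarrow>
      (\<And>t. 0 < t \<Longrightarrow> t < T \<Longrightarrow> obs_at vh wh kh t) \<Longrightarrow> i \<in> {1..N} \<Longrightarrow>
      norm (vh i T) < R \<and> norm (wh i T) < R \<and> norm (kh i T) < R"
proof -
  obtain C where C: "C > 0"
    "\<And>\<mu> \<omega> \<kappa> (e :: nat \<Rightarrow> real^'m) (w :: nat \<Rightarrow> real^'l) k i. \<mu> > 0 \<Longrightarrow> i \<in> {1..N} \<Longrightarrow>
      (norm (e i))\<^sup>2 \<le> C * lyapunov N Eg \<mu> \<omega> \<kappa> e w k \<and>
      (norm (w i - \<omega>))\<^sup>2 \<le> 2 * \<mu> * lyapunov N Eg \<mu> \<omega> \<kappa> e w k \<and>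
      (norm (k i - \<kappa>))\<^sup>2 \<le> 2 * lyapunov N Eg \<mu> \<omega> \<kappa> e w k"
    using lyapunov_bounds by blast
  define V0 where "V0 = \<bar>lyapunov N Eg \<mu> \<omega> \<kappa> (\<lambda>i. v0 i - v 0) w0 k0\<bar>"
  \<comment> \<open>A norm with x^2 \<le> c V0 satisfies x \<le> 1 + c V0. Summing the three
    estimates and the norms of the centres avoids a maximum; 2 in place of 1 makes the bound
    strict.\<close>
  define R where "R = 2 + (C * V0 + 2 * \<mu> * V0 + 2 * V0) + (Rv + norm \<omega> + \<bar>\<kappa>\<bar>)"
  have Rv: "Rv \<ge> 0" using v_bound[of 0] norm_ge_zero order_trans by blast
  have V0: "V0 \<ge> 0" "C * V0 \<ge> 0" "2 * \<mu> * V0 \<ge> 0" using C \<mu> by (auto simp: V0_def)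
  show thesis
  proof
    show "R > 0" unfolding R_def using V0 Rv by (simp add: add_pos_nonneg)
    fix vh wh kh and T :: real and i
    assume T: "T \<ge> 0" and init: "\<And>i. i \<in> {1..N} \<Longrightarrow> vh i 0 = v0 i \<and> wh i 0 = w0 i \<and> kh i 0 = k0 i"
      and cont: "\<And>i. i \<in> {1..N} \<Longrightarrow> continuous_on {0..T} (vh i)" "\<And>i. i \<in> {1..N} \<Longrightarrow> continuous_on {0..T} (wh i)"
      "\<And>i. i \<in> {1..N} \<Longrightarrow> continuous_on {0..T} (kh i)"
      and obs: "\<And>t. 0 < t \<Longrightarrow> t < T \<Longrightarrow> obs_at vh wh kh t" and i: "i \<in> {1..N}"
    define V where "V = lyapunov N Eg \<mu> \<omega> \<kappa> (\<lambda>i. vh i T - v T) (\<lambda>i. wh i T) (\<lambda>i. kh i T)"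
    have "V \<le> lyapunov N Eg \<mu> \<omega> \<kappa> (\<lambda>i. vh i 0 - v 0) (\<lambda>i. wh i 0) (\<lambda>i. kh i 0)"
      unfolding V_def by (rule lyapunov_nonincreasing[OF T cont obs])
    also have "\<dots> = lyapunov N Eg \<mu> \<omega> \<kappa> (\<lambda>i. v0 i - v 0) w0 k0"
      using init by (intro lyapunov_cong) auto
    finally have V_le: "V \<le> V0" unfolding V0_def by linarith
    have le: "x \<le> 1 + c * V0" if "x\<^sup>2 \<le> c * V" "c \<ge> 0" for x c :: real
    proof -
      have "2 * x \<le> x\<^sup>2 + 1" using sum_squares_bound[of x 1] by simp
      moreover have "x\<^sup>2 \<ge> 0" by simp
      ultimately have "x \<le> 1 + x\<^sup>2" by linarith
      moreover have "c * V \<le> c * V0" using V_le that(2) by (rule mult_left_mono)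
      ultimately show ?thesis using that(1) by linarith
    qed
    have "norm (vh i T - v T) \<le> 1 + C * V0" "norm (wh i T - \<omega>) \<le> 1 + 2 * \<mu> * V0" "norm (kh i T - \<kappa>) \<le> 1 + 2 * V0"
      using C(2)[OF \<mu> i, of "\<lambda>i. vh i T - v T" \<omega> \<kappa> "\<lambda>i. wh i T" "\<lambda>i. kh i T"] C(1) \<mu>
      unfolding V_def[symmetric] by (auto intro!: le)
    moreover have "norm (vh i T) \<le> norm (vh i T - v T) + Rv"
      using norm_triangle_ineq[of "vh i T - v T" "v T"] v_bound[OF T] by simp
    moreover have "norm (wh i T) \<le> norm (wh i T - \<omega>) + norm \<omega>"
      using norm_triangle_ineq[of "wh i T - \<omega>" "\<omega>"] by simp
    moreover have "norm (kh i T) \<le> norm (kh i T - \<kappa>) + \<bar>\<kappa>\<bar>"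
      using norm_triangle_ineq[of "kh i T - \<kappa>" "\<kappa>"] by simp
    ultimately show "norm (vh i T) < R \<and> norm (wh i T) < R \<and> norm (kh i T) < R"
      unfolding R_def using V0 Rv norm_ge_zero[of \<omega>] abs_ge_zero[of \<kappa>] by linarith
  qed
qed

end

section \<open>Existence of observer trajectories\<close>

definition trunc :: "real \<Rightarrow> 'a::euclidean_space \<Rightarrow> 'a" where
  "trunc R x = closest_point (cball 0 R) x"

lemma trunc_self: "norm x \<le> R \<Longrightarrow> trunc R x = x"
  by (simp add: trunc_def closest_point_self)

lemma continuous_on_trunc: "R \<ge> 0 \<Longrightarrow> continuous_on S (trunc R)"
  unfolding trunc_def[abs_def] by (intro continuous_on_closest_point) auto

lemma (in observer_graph) blip_lap:
  assumes e: "\<And>j. j \<in> {1..N} \<Longrightarrow> blip S D (\<lambda>p. e p j)" and i: "i \<in> {1..N}"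
  shows "blip S D (\<lambda>p. lap (e p) i)"
  unfolding laplacian_err_def
proof (intro blip_sum blip_diff)
  fix j assume "j \<in> nbrs Eg i"
  then have "j = N + 1 \<or> j \<in> {1..N}" using nbrs_subset[of i] by fastforce
  then show "blip S D (\<lambda>s. if j = N + 1 then 0 else e s j)" using e by (auto intro: blip_const)
qed (rule e[OF i])

context gained_observer
begin

lemma blip_observer_rhs:
  fixes x :: "nat \<Rightarrow> 'p \<Rightarrow> real^'m" and w :: "nat \<Rightarrow> 'p \<Rightarrow> real^'l" and k :: "nat \<Rightarrow> 'p \<Rightarrow> real"
  assumes x: "\<And>j. j \<in> {1..N} \<Longrightarrow> blip S D (x j)" and w: "\<And>j. j \<in> {1..N} \<Longrightarrow> blip S D (w j)"
    and k: "\<And>j. j \<in> {1..N} \<Longrightarrow> blip S D (k j)" and u: "blip S D u" and i: "i \<in> {1..N}"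
  defines "z \<equiv> \<lambda>p. lap (\<lambda>j. x j p - u p) i"
  shows "blip S D z"
    "blip S D (\<lambda>p. phi (x i p) *v w i p + (k i p * \<rho> (z p)) *\<^sub>R z p)"
    "blip S D (\<lambda>p. \<mu> *\<^sub>R (transpose (phi (x i p)) *v z p))"
    "blip S D (\<lambda>p. \<rho> (z p) * (z p \<bullet> z p))"
proof -
  show z: "blip S D z" unfolding z_def by (intro blip_lap blip_diff x u i)
  have \<rho>z: "blip S D (\<lambda>p. \<rho> (z p))" using z \<rho> by (rule blip_smooth)
  have phi_x: "blip S D (\<lambda>p. phi (x i p))" using x[OF i] phi by (rule blip_smooth)
  have kz: "blip S D (\<lambda>p. (k i p * \<rho> (z p)) *\<^sub>R z p)"
    by (intro bounded_bilinear.blip[OF bounded_bilinear_scaleR] bounded_bilinear.blip[OF bounded_bilinear_mult] k i \<rho>z z)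
  show "blip S D (\<lambda>p. phi (x i p) *v w i p + (k i p * \<rho> (z p)) *\<^sub>R z p)"
    by (intro blip_add bounded_bilinear.blip[OF bounded_bilinear_matrix_vector_mult] phi_x w i kz)
  show "blip S D (\<lambda>p. \<mu> *\<^sub>R (transpose (phi (x i p)) *v z p))"
    by (intro bounded_linear.blip[OF bounded_linear_scaleR_right] bounded_bilinear.blip[OF bounded_bilinear_matrix_vector_mult]
        bounded_linear.blip[OF bounded_linear_transpose] phi_x z)
  show "blip S D (\<lambda>p. \<rho> (z p) * (z p \<bullet> z p))"
    by (intro bounded_bilinear.blip[OF bounded_bilinear_mult] bounded_bilinear.blip[OF bounded_bilinear_inner] \<rho>z z)
qed

lemma continuous_on_observer_rhs:
  assumes x: "\<And>j. j \<in> {1..N} \<Longrightarrow> continuous_on S (x j)" and w: "\<And>j. j \<in> {1..N} \<Longrightarrow> continuous_on S (w j)"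
    and k: "\<And>j. j \<in> {1..N} \<Longrightarrow> continuous_on S (k j)" and u: "continuous_on S u" and i: "i \<in> {1..N}"
  defines "z \<equiv> \<lambda>p::real. lap (\<lambda>j. x j p - u p) i"
  shows "continuous_on S (\<lambda>p. phi (x i p) *v w i p + (k i p * \<rho> (z p)) *\<^sub>R z p)"
    "continuous_on S (\<lambda>p. \<mu> *\<^sub>R (transpose (phi (x i p)) *v z p))"
    "continuous_on S (\<lambda>p. \<rho> (z p) * (z p \<bullet> z p))"
proof -
  have z: "continuous_on S z" unfolding z_def by (intro continuous_on_lap continuous_on_diff x u i)
  have \<rho>z: "continuous_on S (\<lambda>p. \<rho> (z p))"
    by (rule continuous_on_compose2[OF smooth_fun_continuous_on[OF \<rho>, of UNIV] z]) auto
  have phi_x: "continuous_on S (\<lambda>p. phi (x i p))"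
    by (rule continuous_on_compose2[OF smooth_fun_continuous_on[OF phi, of UNIV] x[OF i]]) auto
  show "continuous_on S (\<lambda>p. phi (x i p) *v w i p + (k i p * \<rho> (z p)) *\<^sub>R z p)"
    by (intro continuous_on_add continuous_on_scaleR continuous_on_mult
        bounded_bilinear.continuous_on[OF bounded_bilinear_matrix_vector_mult] phi_x w k \<rho>z z i)
  show "continuous_on S (\<lambda>p. \<mu> *\<^sub>R (transpose (phi (x i p)) *v z p))"
    by (intro continuous_on_scaleR continuous_on_const bounded_bilinear.continuous_on[OF bounded_bilinear_matrix_vector_mult]
        bounded_linear.continuous_on[OF bounded_linear_transpose] phi_x z)
  show "continuous_on S (\<lambda>p. \<rho> (z p) * (z p \<bullet> z p))"
    by (intro continuous_on_mult continuous_on_inner \<rho>z z)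
qed

text \<open>The vector field is truncated outside the box given by the a priori bound. Up to its first exit
  time a solution of the truncated system solves the observer equations, so the bound keeps it
  strictly inside the box at that time as well.\<close>

lemma ex_observer_solution:
  obtains vh wh kh where "\<And>t. t \<ge> 0 \<Longrightarrow> obs_at vh wh kh t"
    "\<And>i. i \<in> {1..N} \<Longrightarrow> vh i 0 = v0 i \<and> wh i 0 = w0 i \<and> kh i 0 = k0 i"
proof -
  obtain R where R: "R > 0"
    "\<And>vh wh kh T i. T \<ge> 0 \<Longrightarrow>
      (\<And>i. i \<in> {1..N} \<Longrightarrow> vh i 0 = v0 i \<and> wh i 0 = w0 i \<and> kh i 0 = k0 i) \<Longrightarrow>
      (\<And>i. i \<in> {1..N} \<Longrightarrow> continuous_on {0..T} (vh i)) \<Longrightarrow>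
      (\<And>i. i \<in> {1..N} \<Longrightarrow> continuous_on {0..T} (wh i)) \<Longrightarrow>
      (\<And>i. i \<in> {1..N} \<Longrightarrow> continuous_on {0..T} (kh i)) \<Longrightarrow>
      (\<And>t. 0 < t \<Longrightarrow> t < T \<Longrightarrow> obs_at vh wh kh t) \<Longrightarrow> i \<in> {1..N} \<Longrightarrow>
      norm (vh i T) < R \<and> norm (wh i T) < R \<and> norm (kh i T) < R"
    using observer_bound[of v0 w0 k0] by blast
  define X where "X j p = trunc R (fst (snd p j))"
    for j and p :: "real \<times> (nat \<Rightarrow> (real^'m) \<times> (real^'l) \<times> real)"
  define W where "W j p = trunc R (fst (snd (snd p j)))"
    for j and p :: "real \<times> (nat \<Rightarrow> (real^'m) \<times> (real^'l) \<times> real)"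
  define K where "K j p = trunc R (snd (snd (snd p j)))"
    for j and p :: "real \<times> (nat \<Rightarrow> (real^'m) \<times> (real^'l) \<times> real)"
  define Z where "Z i p = lap (\<lambda>j. X j p - v (fst p)) i" for i p
  define F where "F i p = (phi (X i p) *v W i p + (K i p * \<rho> (Z i p)) *\<^sub>R Z i p,
      \<mu> *\<^sub>R (transpose (phi (X i p)) *v Z i p), \<rho> (Z i p) * (Z i p \<bullet> Z i p))" for i p
  have close: "norm (fst (snd p j) - fst (snd q j)) \<le> d"
    "norm (fst (snd (snd p j)) - fst (snd (snd q j))) \<le> d"
    "norm (snd (snd (snd p j)) - snd (snd (snd q j))) \<le> d"
    if "state_close p q d" for p q :: "real \<times> (nat \<Rightarrow> (real^'m) \<times> (real^'l) \<times> real)" and d j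
  proof -
    have *: "norm (snd p j - snd q j) \<le> d" using that by (auto split: prod.splits)
    have "norm (fst (snd p j - snd q j)) \<le> norm (snd p j - snd q j)"
      "norm (snd (snd p j - snd q j)) \<le> norm (snd p j - snd q j)"
      "norm (fst (snd (snd p j - snd q j))) \<le> norm (snd (snd p j - snd q j))"
      "norm (snd (snd (snd p j - snd q j))) \<le> norm (snd (snd p j - snd q j))"
      by (metis norm_fst_le prod.collapse, metis norm_snd_le prod.collapse,
          metis norm_fst_le prod.collapse, metis norm_snd_le prod.collapse)
    then show "norm (fst (snd p j) - fst (snd q j)) \<le> d"
      "norm (fst (snd (snd p j)) - fst (snd (snd q j))) \<le> d"
      "norm (snd (snd (snd p j)) - snd (snd (snd q j))) \<le> d"
      using * unfolding fst_diff snd_diff by linarith+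
  qed
  have blip_comp: "blip states state_close (X j)" "blip states state_close (W j)" "blip states state_close (K j)" for j
    unfolding X_def[abs_def] W_def[abs_def] K_def[abs_def] trunc_def
    using R(1) close by (intro blip_closest_point; force)+
  \<comment> \<open>The leader enters as a function of time only, and close states share their time,
    so the Lipschitz constant is 0.\<close>
  have blip_v: "blip states state_close (\<lambda>p::real \<times> (nat \<Rightarrow> (real^'m) \<times> (real^'l) \<times> real). v (fst p))"
    by (rule blipI[of _ _ Rv _ 0]) (use v_bound in auto)
  have "blip states state_close (F i)" if i: "i \<in> {1..N}" for i
    unfolding F_def[abs_def] Z_def[abs_def]
    by (intro blip_Pair blip_observer_rhs[where x = X and w = W and k = K and u = "\<lambda>p. v (fst p)"] blip_comp blip_v i)
  moreover have "(\<lambda>(t, x). F i (t, x)) = F i" for i by auto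
  ultimately have F_blip: "blip states state_close (\<lambda>(t, x). F i (t, x))" if "i \<in> {1..N}" for i
    using that by simp
  have F_cont: "continuous_on {0..} (\<lambda>t. F i (t, \<lambda>j. x j t))"
    if i: "i \<in> {1..N}" and x: "\<And>j. continuous_on {0..} (x j)" for i x
  proof -
    have "continuous_on {0..} (\<lambda>t. X j (t, \<lambda>j. x j t))" "continuous_on {0..} (\<lambda>t. W j (t, \<lambda>j. x j t))"
      "continuous_on {0..} (\<lambda>t. K j (t, \<lambda>j. x j t))" for j
      unfolding X_def W_def K_def fst_conv snd_conv using R(1)
      by (intro continuous_on_compose2[OF continuous_on_trunc[of R UNIV]] continuous_on_fst continuous_on_snd x; simp)+
    then show ?thesis
      unfolding F_def Z_def fst_conv
      by (intro continuous_on_Pair continuous_on_observer_rhs[where x = "\<lambda>j t. X j (t, \<lambda>j. x j t)" and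
          w = "\<lambda>j t. W j (t, \<lambda>j. x j t)" and k = "\<lambda>j t. K j (t, \<lambda>j. x j t)" and u = v] v_cont i)
  qed
  obtain x where x0: "\<And>i. i \<in> {1..N} \<Longrightarrow> x i 0 = (v0 i, w0 i, k0 i)"
    and x': "\<And>i t. i \<in> {1..N} \<Longrightarrow> t \<ge> 0 \<Longrightarrow> (x i has_vector_derivative F i (t, \<lambda>j. x j t)) (at t within {0..})"
    by (rule ex_solution_blip_ode[of "{1..N}" "\<lambda>i t x. F i (t, x)" "\<lambda>i. (v0 i, w0 i, k0 i)"])
      (simp, rule F_blip, assumption, rule F_cont, auto)
  define vh where "vh i t = fst (x i t)" for i t
  define wh where "wh i t = fst (snd (x i t))" for i t
  define kh where "kh i t = snd (snd (x i t))" for i t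
  define box where "box i t \<longleftrightarrow> norm (vh i t) < R \<and> norm (wh i t) < R \<and> norm (kh i t) < R" for i t
  have init: "vh i 0 = v0 i \<and> wh i 0 = w0 i \<and> kh i 0 = k0 i" if "i \<in> {1..N}" for i
    using x0[OF that] by (simp add: vh_def wh_def kh_def)
  have x_cont: "continuous_on {0..} (x i)" if "i \<in> {1..N}" for i
    by (rule continuous_on_vector_derivative) (use x'[OF that] in auto)
  have conts: "continuous_on {0..} (vh i)" "continuous_on {0..} (wh i)" "continuous_on {0..} (kh i)"
    if "i \<in> {1..N}" for i
    unfolding vh_def[abs_def] wh_def[abs_def] kh_def[abs_def]
    by (intro continuous_on_fst continuous_on_snd x_cont that)+
  have obs: "obs_at vh wh kh t" if t: "t \<ge> 0" and inside: "\<And>i. i \<in> {1..N} \<Longrightarrow> box i t" for t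
    unfolding observer_at_def Let_def
  proof (intro ballI)
    fix i assume i: "i \<in> {1..N}"
    let ?p = "(t, \<lambda>j. x j t)"
    have comps: "X j ?p = vh j t" "W j ?p = wh j t" "K j ?p = kh j t" if "j \<in> {1..N}" for j
      using inside[OF that] by (auto simp: X_def W_def K_def box_def vh_def wh_def kh_def intro!: trunc_self)
    have z: "Z i ?p = lap (\<lambda>i. vh i t - v t) i"
      unfolding Z_def using comps by (intro lap_cong i) auto
    note d = x'[OF i t]
    note d1 = bounded_linear.has_vector_derivative[OF bounded_linear_fst d]
    note d2 = bounded_linear.has_vector_derivative[OF bounded_linear_snd d]
    note d3 = bounded_linear.has_vector_derivative[OF bounded_linear_fst d2]
    note d4 = bounded_linear.has_vector_derivative[OF bounded_linear_snd d2]
    from d1 d3 d4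
    show "(vh i has_vector_derivative phi (vh i t) *v wh i t + (kh i t * \<rho> (lap (\<lambda>i. vh i t - v t) i)) *\<^sub>R lap (\<lambda>i. vh i t - v t) i) (at t within {0..}) \<and>
      (wh i has_vector_derivative \<mu> *\<^sub>R (transpose (phi (vh i t)) *v lap (\<lambda>i. vh i t - v t) i)) (at t within {0..}) \<and>
      (kh i has_vector_derivative \<rho> (lap (\<lambda>i. vh i t - v t) i) * (lap (\<lambda>i. vh i t - v t) i \<bullet> lap (\<lambda>i. vh i t - v t) i)) (at t within {0..})"
      unfolding F_def z comps[OF i] fst_conv snd_conv vh_def[symmetric] wh_def[symmetric] kh_def[symmetric]
      by blast
  qed
  have inside: "box i t" if "t \<ge> 0" "i \<in> {1..N}" for i t
  proof (rule ccontr)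
    assume "\<not> box i t"
    \<comment> \<open>Times outside the open box form a closed set, so its infimum is a genuine
      first exit time. If it is 0, the open interval before it is empty and the bound speaks of the
      initial state.\<close>
    define A where "A = (\<Union>i\<in>{1..N}. {t\<in>{0..}. R \<le> norm (vh i t)} \<union> {t\<in>{0..}. R \<le> norm (wh i t)}
      \<union> {t\<in>{0..}. R \<le> norm (kh i t)})"
    have mem_A: "s \<in> A \<longleftrightarrow> s \<ge> 0 \<and> (\<exists>i\<in>{1..N}. \<not> box i s)" for s
      unfolding A_def box_def by (auto simp: not_less)
    have "closed A" unfolding A_def
      by (intro closed_UN ballI closed_Un continuous_on_closed_Collect_le continuous_on_norm continuous_on_const conts) auto
    moreover have "A \<noteq> {}" using \<open>\<not> box i t\<close> that mem_A by blast
    moreover have bdd: "bdd_below A" by (rule bdd_belowI[of _ 0]) (auto simp: mem_A)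
    ultimately have "Inf A \<in> A" using closed_contains_Inf by blast
    then obtain j where j: "Inf A \<ge> 0" "j \<in> {1..N}" "\<not> box j (Inf A)" using mem_A by blast
    have "obs_at vh wh kh s" if "0 < s" "s < Inf A" for s
    proof (rule obs)
      have "s \<notin> A" using cInf_lower[OF _ bdd, of s] that by auto
      then show "box i s" if "i \<in> {1..N}" for i using mem_A that \<open>0 < s\<close> by auto
    qed (use that in auto)
    moreover have "continuous_on {0..Inf A} (vh i)" "continuous_on {0..Inf A} (wh i)" "continuous_on {0..Inf A} (kh i)"
      if "i \<in> {1..N}" for i
      using conts[OF that] by (auto elim!: continuous_on_subset)
    ultimately have "box j (Inf A)" unfolding box_def
      using init j by (intro R(2)) auto
    then show False using j by blast
  qed
  show thesis using that[of vh wh kh] obs inside init by blast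
qed

end

section \<open>Convergence\<close>

lemma (in bounded_bilinear) tendsto_zero_bounded_left:
  assumes "\<forall>\<^sub>F t in A. norm (F t) \<le> B" and "(G \<longlongrightarrow> 0) A"
  shows "((\<lambda>t. prod (F t) (G t)) \<longlongrightarrow> 0) A"
proof -
  obtain K where K: "K \<ge> 0" "\<And>x y. norm (prod x y) \<le> norm x * norm y * K"
    using nonneg_bounded by blast
  show ?thesis
  proof (rule Lim_null_comparison)
    show "\<forall>\<^sub>F t in A. norm (prod (F t) (G t)) \<le> B * norm (G t) * K"
      using assms(1)
    proof eventually_elim
      case (elim t)
      have "norm (prod (F t) (G t)) \<le> norm (F t) * norm (G t) * K" by (rule K)
      also have "\<dots> \<le> B * norm (G t) * K" using elim K(1) by (intro mult_right_mono) auto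
      finally show ?case .
    qed
    show "((\<lambda>t. B * norm (G t) * K) \<longlongrightarrow> 0) A"
      using assms(2) by (intro tendsto_mult_left_zero tendsto_mult_right_zero tendsto_norm_zero)
  qed
qed

lemma bounded_bilinear_matrix_matrix_mult:
  "bounded_bilinear ((**) :: real^'n^'m \<Rightarrow> real^'k^'n \<Rightarrow> real^'k^'m)"
  unfolding bilinear_conv_bounded_bilinear[symmetric] bilinear_def
  by (auto intro!: linearI simp: matrix_matrix_mult_def vec_eq_iff sum.distrib distrib_left distrib_right
      sum_distrib_left mult.assoc mult.left_commute)

lemma has_vector_derivative_bound:
  fixes f :: "real \<Rightarrow> 'a::real_normed_vector"
  assumes f': "\<And>t. t \<in> S \<Longrightarrow> (f has_vector_derivative f' t) (at t within S)"
    and "convex S" and "\<And>t. t \<in> S \<Longrightarrow> norm (f' t) \<le> M" and "s \<in> S" "t \<in> S"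
  shows "norm (f s - f t) \<le> M * \<bar>s - t\<bar>"
proof -
  have "norm (f s - f t) \<le> M * norm (s - t)"
  proof (rule differentiable_bound[of S f "\<lambda>t h. h *\<^sub>R f' t"])
    fix t assume t: "t \<in> S"
    show "(f has_derivative (\<lambda>h. h *\<^sub>R f' t)) (at t within S)"
      using f'[OF t] by (simp add: has_vector_derivative_def)
    show "onorm (\<lambda>h. h *\<^sub>R f' t) \<le> M"
      using mult_right_mono[OF assms(3)[OF t] abs_ge_zero] by (intro onorm_le) (simp add: mult.commute)
  qed (use assms(2,4,5) in auto)
  then show ?thesis by simp
qed

lemma blip_bounded:
  assumes "blip S D F"
  obtains B where "\<And>p. p \<in> S \<Longrightarrow> norm (F p) \<le> B"
  using assms unfolding blip_def by blast

lemma blip_eventually_bounded: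
  assumes "blip {0..} D (f :: real \<Rightarrow> 'b::real_normed_vector)"
  obtains B where "\<forall>\<^sub>F t in at_top. norm (f t) \<le> B"
proof -
  obtain B where B: "\<And>t. t \<in> {0..} \<Longrightarrow> norm (f t) \<le> B" by (rule blip_bounded[OF assms]) blast
  have "\<forall>\<^sub>F t in at_top. norm (f t) \<le> B"
    using eventually_ge_at_top[of 0] by eventually_elim (use B in auto)
  then show thesis using that by blast
qed

lemma blip_of_bounded_derivative:
  fixes f :: "real \<Rightarrow> 'b::real_normed_vector"
  assumes f': "\<And>t. t \<ge> 0 \<Longrightarrow> (f has_vector_derivative f' t) (at t within {0..})"
    and f_bd: "blip {0..} D f" and f'_bd: "blip {0..} D' f'"
  shows "blip {0..} (\<lambda>s t d. d = \<bar>s - t\<bar>) f"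
proof -
  obtain B where B: "\<And>t. t \<in> {0..} \<Longrightarrow> norm (f t) \<le> B" by (rule blip_bounded[OF f_bd]) blast
  obtain M where M: "\<And>t. t \<in> {0..} \<Longrightarrow> norm (f' t) \<le> M" by (rule blip_bounded[OF f'_bd]) blast
  have "norm (f s - f t) \<le> M * \<bar>s - t\<bar>" if "s \<in> {0..}" "t \<in> {0..}" for s t
    by (rule has_vector_derivative_bound[OF _ _ M that]) (use f' in auto)
  then show ?thesis using B by (intro blipI[of _ _ B _ M]) auto
qed

lemma mono_bounded_tendsto_at_top:
  fixes f :: "real \<Rightarrow> real"
  assumes mono: "\<And>s t. 0 \<le> s \<Longrightarrow> s \<le> t \<Longrightarrow> f s \<le> f t" and bound: "\<And>t. 0 \<le> t \<Longrightarrow> f t \<le> B"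
  obtains l where "(f \<longlongrightarrow> l) at_top"
proof
  have bdd: "bdd_above (f ` {0..})" using bound by (auto intro!: bdd_aboveI)
  show "(f \<longlongrightarrow> (SUP t\<in>{0..}. f t)) at_top"
  proof (rule increasing_tendsto)
    show "\<forall>\<^sub>F t in at_top. f t \<le> (SUP t\<in>{0..}. f t)"
      using eventually_ge_at_top[of 0] by eventually_elim (auto intro!: cSUP_upper bdd)
    fix x assume "x < (SUP t\<in>{0..}. f t)"
    then obtain s where s: "s \<ge> 0" "x < f s" using less_cSUP_iff[OF _ bdd] by auto
    show "\<forall>\<^sub>F t in at_top. x < f t"
      using eventually_ge_at_top[of s] by eventually_elim (use s mono in force)
  qed
qed

text \<open>On a window of length \<open>T\<^sub>0\<close> the vector \<open>w\<close> is almost constant, so \<open>F s *v w t\<close> is uniformly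
  small there, and the excitation inequality tested on \<open>w t\<close> forces \<open>w t\<close> to be small.\<close>

lemma persistently_exciting_imp_tendsto_zero:
  fixes F :: "real \<Rightarrow> real^'l^'m" and w :: "real \<Rightarrow> real^'l"
  assumes PE: "persistently_exciting (\<lambda>t. transpose (F t))"
    and F_cont: "continuous_on {0..} F"
    and F_bound: "\<And>t. t \<ge> 0 \<Longrightarrow> norm (F t) \<le> B"
    and w': "\<And>t. t \<ge> 0 \<Longrightarrow> (w has_vector_derivative w' t) (at t within {0..})"
    and w'_lim: "(w' \<longlongrightarrow> 0) at_top"
    and Fw: "((\<lambda>t. F t *v w t) \<longlongrightarrow> 0) at_top"
  shows "(w \<longlongrightarrow> 0) at_top"
proof (rule tendstoI)
  fix e :: real assume e: "e > 0"
  obtain \<epsilon> t0 T0 where \<epsilon>: "\<epsilon> > 0" and t0: "t0 > 0" and T0: "T0 > 0"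
    and exc: "\<And>t x. t \<ge> t0 \<Longrightarrow> \<epsilon> * (x \<bullet> x) \<le>
      (1 / T0) * (x \<bullet> (integral {t..t + T0} (\<lambda>s. transpose (F s) ** transpose (transpose (F s))) *v x))"
    using PE unfolding persistently_exciting_def by blast
  obtain K where K: "K \<ge> 0" "\<And>(A :: real^'l^'m) x. norm (A *v x) \<le> norm A * norm x * K"
    using bounded_bilinear.nonneg_bounded[OF bounded_bilinear_matrix_vector_mult] by blast
  have B: "B \<ge> 0" using F_bound[of 0] norm_ge_zero order_trans by blast
  \<comment> \<open>Over the window \<open>w\<close> moves by at most \<eta> T0, which
    \<open>F s\<close> amplifies by at most B K; the 1 accounts for \<open>F s *v w s\<close>
    itself. With the \<eta> below, the square of \<eta> M is \<epsilon> (e/2)^2, matching the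
    excitation level.\<close>
  define M where "M = 1 + B * T0 * K"
  have M: "M > 0" using B T0 K by (simp add: M_def add_pos_nonneg)
  define \<eta> where "\<eta> = sqrt \<epsilon> * e / (2 * M)"
  have \<eta>: "\<eta> > 0" "\<eta> * M = sqrt \<epsilon> * (e / 2)" using \<epsilon> e M by (auto simp: \<eta>_def)
  have "\<forall>\<^sub>F t in at_top. norm (w' t) < \<eta> \<and> norm (F t *v w t) < \<eta>"
    using tendstoD[OF w'_lim \<eta>(1)] tendstoD[OF Fw \<eta>(1)] by (simp add: eventually_conj)
  then obtain T1 where T1: "\<And>t. t \<ge> T1 \<Longrightarrow> norm (w' t) < \<eta> \<and> norm (F t *v w t) < \<eta>"
    unfolding eventually_at_top_linorder by blast
  show "\<forall>\<^sub>F t in at_top. dist (w t) 0 < e"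
    unfolding eventually_at_top_linorder
  proof (intro exI allI impI)
    fix t assume "t \<ge> max T1 t0"
    then have t: "t \<ge> T1" "t \<ge> t0" "t \<ge> 0" using t0 by auto
    have small: "norm (F s *v w t) \<le> \<eta> * M" if s: "s \<in> {t..t + T0}" for s
    proof -
      have "norm (w t - w s) \<le> \<eta> * \<bar>t - s\<bar>"
      proof (rule has_vector_derivative_bound[of "{t..t + T0}" w w'])
        fix r assume r: "r \<in> {t..t + T0}"
        show "(w has_vector_derivative w' r) (at r within {t..t + T0})"
          by (rule has_vector_derivative_within_subset[OF w']) (use r t in auto)
        show "norm (w' r) \<le> \<eta>" using T1[of r] r t by auto
      qed (use s T0 in auto)
      also have "\<dots> \<le> \<eta> * T0" using s \<eta> by (intro mult_left_mono) auto
      finally have ws: "norm (w t - w s) \<le> \<eta> * T0" .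
      have "norm (F s *v (w t - w s)) \<le> norm (F s) * norm (w t - w s) * K" by (rule K)
      also have "\<dots> \<le> B * (\<eta> * T0) * K"
        using ws F_bound[of s] s t K(1) B by (intro mult_right_mono mult_mono) auto
      finally have "norm (F s *v (w t - w s)) \<le> B * (\<eta> * T0) * K" .
      moreover have "norm (F s *v w s) < \<eta>" using T1[of s] s t by auto
      moreover have "F s *v w t = F s *v (w t - w s) + F s *v w s"
        by (simp add: matrix_vector_mult_diff_distrib)
      ultimately have "norm (F s *v w t) \<le> B * (\<eta> * T0) * K + \<eta>"
        using norm_triangle_ineq[of "F s *v (w t - w s)" "F s *v w s"] by simp
      then show ?thesis by (simp add: M_def algebra_simps)
    qed
    define q where "q A = w t \<bullet> (A *v w t)" for A :: "real^'l^'l"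
    have q: "bounded_linear q" unfolding q_def
      by (intro bounded_linear_inner_right_comp bounded_bilinear.bounded_linear_left
          bounded_bilinear_matrix_vector_mult)
    have F_cont': "continuous_on {t..t + T0} F"
      by (rule continuous_on_subset[OF F_cont]) (use t in auto)
    \<comment> \<open>Excitation is stated for the transposed signal, whence the double transposes;
      tested on \<open>w t\<close>, the Gram matrix becomes a squared norm.\<close>
    have gram: "q (transpose (F s) ** transpose (transpose (F s))) = (norm (F s *v w t))\<^sup>2" for s
      unfolding q_def transpose_transpose matrix_vector_mul_assoc[symmetric] power2_norm_eq_inner
      by (simp add: transpose_matrix_vector dot_lmul_matrix inner_commute[of "w t"])
    have int: "(\<lambda>s. transpose (F s) ** transpose (transpose (F s))) integrable_on {t..t + T0}"
      unfolding transpose_transpose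
      by (intro integrable_continuous_real bounded_bilinear.continuous_on[OF bounded_bilinear_matrix_matrix_mult]
          bounded_linear.continuous_on[OF bounded_linear_transpose] F_cont')
    have "w t \<bullet> (integral {t..t + T0} (\<lambda>s. transpose (F s) ** transpose (transpose (F s))) *v w t)
        = integral {t..t + T0} (\<lambda>s. (norm (F s *v w t))\<^sup>2)"
      using integral_linear[OF int q] unfolding o_def gram by (simp add: q_def)
    also have "\<dots> \<le> integral {t..t + T0} (\<lambda>s. (\<eta> * M)\<^sup>2)"
    proof (rule integral_le)
      show "(\<lambda>s. (norm (F s *v w t))\<^sup>2) integrable_on {t..t + T0}"
        using integrable_linear[OF int q] unfolding o_def gram .
      show "(norm (F s *v w t))\<^sup>2 \<le> (\<eta> * M)\<^sup>2" if "s \<in> {t..t + T0}" for s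
        using small[OF that] by (intro power_mono) auto
    qed (rule integrable_const_ivl)
    also have "\<dots> = T0 * (\<eta> * M)\<^sup>2" using T0 by simp
    finally have "(1 / T0) * (w t \<bullet> (integral {t..t + T0} (\<lambda>s. transpose (F s) ** transpose (transpose (F s))) *v w t))
        \<le> (1 / T0) * (T0 * (\<eta> * M)\<^sup>2)" using T0 by (intro mult_left_mono) auto
    then have "\<epsilon> * (w t \<bullet> w t) \<le> (\<eta> * M)\<^sup>2" using exc[OF t(2), of "w t"] T0 by simp
    also have "\<dots> = \<epsilon> * (e / 2)\<^sup>2" unfolding \<eta>(2) using \<epsilon> by (simp add: power_mult_distrib power_divide)
    finally have "(norm (w t))\<^sup>2 \<le> (e / 2)\<^sup>2" using \<epsilon> by (simp add: power2_norm_eq_inner)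
    then have "norm (w t) \<le> e / 2" using e by (auto intro: power2_le_imp_le[of _ "e / 2"])
    then show "dist (w t) 0 < e" using e by simp
  qed
qed

section \<open>Convergence along an arbitrary observer solution\<close>

context gained_observer
begin

context
  fixes vh wh kh
  assumes obs: "\<And>t. t \<ge> 0 \<Longrightarrow> obs_at vh wh kh t"
begin

definition zz where "zz i t = lap (\<lambda>j. vh j t - v t) i"

lemma observer_derivs:
  assumes "t \<ge> 0" "i \<in> {1..N}"
  shows "(vh i has_vector_derivative phi (vh i t) *v wh i t + (kh i t * \<rho> (zz i t)) *\<^sub>R zz i t) (at t within {0..})"
    "(wh i has_vector_derivative \<mu> *\<^sub>R (transpose (phi (vh i t)) *v zz i t)) (at t within {0..})"
    "(kh i has_vector_derivative \<rho> (zz i t) * (zz i t \<bullet> zz i t)) (at t within {0..})"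
  using obs[OF assms(1)] assms(2) unfolding observer_at_def Let_def zz_def by blast+

lemma observer_solution_bounded:
  obtains R where "\<And>i t. i \<in> {1..N} \<Longrightarrow> t \<ge> 0 \<Longrightarrow>
    norm (vh i t) \<le> R \<and> norm (wh i t) \<le> R \<and> norm (kh i t) \<le> R"
proof -
  obtain R where R: "R > 0"
    "\<And>vh' wh' kh' T i. T \<ge> 0 \<Longrightarrow>
      (\<And>i. i \<in> {1..N} \<Longrightarrow> vh' i 0 = vh i 0 \<and> wh' i 0 = wh i 0 \<and> kh' i 0 = kh i 0) \<Longrightarrow>
      (\<And>i. i \<in> {1..N} \<Longrightarrow> continuous_on {0..T} (vh' i)) \<Longrightarrow>
      (\<And>i. i \<in> {1..N} \<Longrightarrow> continuous_on {0..T} (wh' i)) \<Longrightarrow>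
      (\<And>i. i \<in> {1..N} \<Longrightarrow> continuous_on {0..T} (kh' i)) \<Longrightarrow>
      (\<And>t. 0 < t \<Longrightarrow> t < T \<Longrightarrow> obs_at vh' wh' kh' t) \<Longrightarrow> i \<in> {1..N} \<Longrightarrow>
      norm (vh' i T) < R \<and> norm (wh' i T) < R \<and> norm (kh' i T) < R"
    using observer_bound[of "\<lambda>i. vh i 0" "\<lambda>i. wh i 0" "\<lambda>i. kh i 0"] by blast
  have conts: "continuous_on {0..T} (vh i)" "continuous_on {0..T} (wh i)" "continuous_on {0..T} (kh i)"
    if "i \<in> {1..N}" for i T
    by (rule continuous_on_vector_derivative,
        rule has_vector_derivative_within_subset, rule observer_derivs, use that in auto)+
  have "norm (vh i t) < R \<and> norm (wh i t) < R \<and> norm (kh i t) < R" if "i \<in> {1..N}" "t \<ge> 0" for i t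
    by (rule R(2)[of t vh wh kh]) (use that conts obs in auto)
  then show thesis using that less_imp_le by blast
qed

text \<open>With the empty relation \<^const>\<open>blip\<close> is plain boundedness; it bounds the right-hand sides and
  hence gives Lipschitz continuity of the solution in time.\<close>

lemma blip_vh_wh_kh:
  assumes i: "i \<in> {1..N}"
  shows "blip {0..} (\<lambda>s t d. d = \<bar>s - t\<bar>) (vh i)" "blip {0..} (\<lambda>s t d. d = \<bar>s - t\<bar>) (wh i)"
    "blip {0..} (\<lambda>s t d. d = \<bar>s - t\<bar>) (kh i)" "blip {0..} (\<lambda>s t d. d = \<bar>s - t\<bar>) v"
proof -
  obtain R where R: "\<And>i t. i \<in> {1..N} \<Longrightarrow> t \<ge> 0 \<Longrightarrow>
    norm (vh i t) \<le> R \<and> norm (wh i t) \<le> R \<and> norm (kh i t) \<le> R"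
    using observer_solution_bounded by blast
  have bd: "blip {0..} (\<lambda>_ _ _. False) (vh j)" "blip {0..} (\<lambda>_ _ _. False) (wh j)"
    "blip {0..} (\<lambda>_ _ _. False) (kh j)" if "j \<in> {1..N}" for j
    using R[OF that] by (intro blipI[of _ _ R _ 0]; simp)+
  have bd_v: "blip {0..} (\<lambda>_ _ _. False) v" using v_bound by (intro blipI[of _ _ Rv _ 0]) auto
  note rhs = blip_observer_rhs[where x = vh and w = wh and k = kh and u = v, OF bd bd_v i, folded zz_def]
  show "blip {0..} (\<lambda>s t d. d = \<bar>s - t\<bar>) (vh i)"
    by (rule blip_of_bounded_derivative[OF observer_derivs(1)[OF _ i] bd(1)[OF i] rhs(2)])
  show "blip {0..} (\<lambda>s t d. d = \<bar>s - t\<bar>) (wh i)"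
    by (rule blip_of_bounded_derivative[OF observer_derivs(2)[OF _ i] bd(2)[OF i] rhs(3)])
  show "blip {0..} (\<lambda>s t d. d = \<bar>s - t\<bar>) (kh i)"
    by (rule blip_of_bounded_derivative[OF observer_derivs(3)[OF _ i] bd(3)[OF i] rhs(4)])
  show "blip {0..} (\<lambda>s t d. d = \<bar>s - t\<bar>) v"
    by (rule blip_of_bounded_derivative[OF v_deriv bd_v])
      (auto intro!: bounded_bilinear.blip[OF bounded_bilinear_matrix_vector_mult] blip_smooth[OF _ phi] bd_v blip_const)
qed

lemmas blip_rhs = blip_observer_rhs[where x = vh and w = wh and k = kh and u = v,
    OF blip_vh_wh_kh(1-3) blip_vh_wh_kh(4), folded zz_def]

lemma blip_zz: "i \<in> {1..N} \<Longrightarrow> blip {0..} (\<lambda>s t d. d = \<bar>s - t\<bar>) (zz i)"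
  using blip_rhs(1) by blast

text \<open>The gain \<open>kh i\<close> is nondecreasing and bounded, so its derivative, which dominates
  \<open>zz i t \<bullet> zz i t\<close>, tends to zero.\<close>

lemma zz_tendsto_zero:
  assumes i: "i \<in> {1..N}"
  shows "(zz i \<longlongrightarrow> 0) at_top"
proof -
  define q where "q t = \<rho> (zz i t) * (zz i t \<bullet> zz i t)" for t
  have q_ge: "zz i t \<bullet> zz i t \<le> q t" for t
    using mult_right_mono[OF \<rho>_ge_1[of "zz i t"], of "zz i t \<bullet> zz i t"] by (simp add: q_def)
  then have q0: "q t \<ge> 0" for t using order_trans[OF inner_ge_zero] by blast
  have k': "(kh i has_vector_derivative q t) (at t within {0..})" if "t \<ge> 0" for t
    using observer_derivs(3)[OF that i] by (simp add: q_def)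
  have mono: "kh i s \<le> kh i t" if "0 \<le> s" "s \<le> t" for s t
  proof (rule DERIV_nonneg_imp_increasing_open[OF that(2)])
    fix r assume r: "s < r" "r < t"
    have "at r within {0..} = at r" using r that by (intro at_within_interior) auto
    then show "\<exists>y. DERIV (kh i) r :> y \<and> 0 \<le> y"
      using k'[of r] q0[of r] r that by (auto simp: has_real_derivative_iff_has_vector_derivative)
  next
    show "continuous_on {s..t} (kh i)"
      by (rule continuous_on_vector_derivative,
          rule has_vector_derivative_within_subset[OF k']) (use that in auto)
  qed
  obtain R where R: "\<And>i t. i \<in> {1..N} \<Longrightarrow> t \<ge> 0 \<Longrightarrow>
    norm (vh i t) \<le> R \<and> norm (wh i t) \<le> R \<and> norm (kh i t) \<le> R"
    using observer_solution_bounded by blast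
  have "kh i t \<le> R" if "t \<ge> 0" for t using R[OF i that] by auto
  then obtain l where l: "(kh i \<longlongrightarrow> l) at_top"
    using mono_bounded_tendsto_at_top[of "kh i" R] mono by blast
  have "blip {0..} (\<lambda>s t d. d = \<bar>s - t\<bar>) q" unfolding q_def using blip_rhs(4)[OF _ _ _ i] i by blast
  then obtain L where L: "\<And>s t. s \<in> {0..} \<Longrightarrow> t \<in> {0..} \<Longrightarrow> norm (q s - q t) \<le> L * \<bar>s - t\<bar>"
    unfolding blip_def by (metis abs_ge_zero)
  have "(q \<longlongrightarrow> 0) at_top"
    by (rule tendsto_zero_of_lipschitz_derivative[of "kh i" q "\<lambda>_. 0" l L]) (use k' l L in auto)
  then have "((\<lambda>t. zz i t \<bullet> zz i t) \<longlongrightarrow> 0) at_top"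
    by (rule Lim_null_comparison[rotated]) (use q_ge in auto)
  then have "((\<lambda>t. sqrt (zz i t \<bullet> zz i t)) \<longlongrightarrow> sqrt 0) at_top" by (rule tendsto_real_sqrt)
  then show ?thesis by (simp add: norm_eq_sqrt_inner[symmetric] tendsto_norm_zero_iff)
qed

text \<open>The index whose \<open>zz\<close> dominates the error may change with time, hence the
  sum over all followers as comparison function.\<close>

lemma error_tendsto_zero:
  assumes i: "i \<in> {1..N}"
  shows "((\<lambda>t. vh i t - v t) \<longlongrightarrow> 0) at_top"
proof -
  obtain C where C: "C > 0"
    "\<And>e :: nat \<Rightarrow> real^'m. \<exists>j\<in>{1..N}. \<forall>i\<in>{1..N}. norm (e i) \<le> C * norm (lap e j)"
    using lap_bounded_below by blast
  show ?thesis
  proof (rule Lim_null_comparison)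
    have "norm (vh i t - v t) \<le> C * (\<Sum>j\<in>{1..N}. norm (zz j t))" for t
    proof -
      obtain j where j: "j \<in> {1..N}" "norm (vh i t - v t) \<le> C * norm (zz j t)"
        using C(2)[of "\<lambda>j. vh j t - v t"] i unfolding zz_def by blast
      have "norm (zz j t) \<le> (\<Sum>j\<in>{1..N}. norm (zz j t))" by (rule member_le_sum[OF j(1)]) auto
      then show ?thesis using j(2) mult_left_mono[OF _ less_imp_le[OF C(1)]] order_trans by blast
    qed
    then show "\<forall>\<^sub>F t in at_top. norm (vh i t - v t) \<le> C * (\<Sum>j\<in>{1..N}. norm (zz j t))" by simp
    show "((\<lambda>t. C * (\<Sum>j\<in>{1..N}. norm (zz j t))) \<longlongrightarrow> 0) at_top"
      by (intro tendsto_mult_right_zero tendsto_null_sum tendsto_norm_zero zz_tendsto_zero)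
  qed
qed

lemma phi_error_tendsto_zero:
  assumes i: "i \<in> {1..N}"
  shows "((\<lambda>t. phi (vh i t) - phi (v t)) \<longlongrightarrow> 0) at_top"
proof -
  obtain R where R: "\<And>i t. i \<in> {1..N} \<Longrightarrow> t \<ge> 0 \<Longrightarrow>
    norm (vh i t) \<le> R \<and> norm (wh i t) \<le> R \<and> norm (kh i t) \<le> R"
    using observer_solution_bounded by blast
  obtain L where L: "L \<ge> 0" "\<And>x y. norm x \<le> max R Rv \<Longrightarrow> norm y \<le> max R Rv \<Longrightarrow>
      norm (phi x - phi y) \<le> L * norm (x - y)"
    using smooth_fun_lipschitz_on_cball[OF phi] by blast
  show ?thesis
  proof (rule Lim_null_comparison)
    show "\<forall>\<^sub>F t in at_top. norm (phi (vh i t) - phi (v t)) \<le> L * norm (vh i t - v t)"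
      using eventually_ge_at_top[of 0]
    proof eventually_elim
      case (elim t)
      then show ?case using R[OF i elim] v_bound[OF elim] by (intro L) auto
    qed
    show "((\<lambda>t. L * norm (vh i t - v t)) \<longlongrightarrow> 0) at_top"
      by (intro tendsto_mult_right_zero tendsto_norm_zero error_tendsto_zero i)
  qed
qed

lemma parameter_derivative_tendsto_zero:
  assumes i: "i \<in> {1..N}"
  shows "((\<lambda>t. \<mu> *\<^sub>R (transpose (phi (vh i t)) *v zz i t)) \<longlongrightarrow> 0) at_top"
proof -
  obtain B where "\<forall>\<^sub>F t in at_top. norm (transpose (phi (vh i t))) \<le> B"
    by (rule blip_eventually_bounded[OF bounded_linear.blip[OF bounded_linear_transpose
          blip_smooth[OF blip_vh_wh_kh(1)[OF i] phi]]])
  then have "((\<lambda>t. transpose (phi (vh i t)) *v zz i t) \<longlongrightarrow> 0) at_top"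
    by (rule bounded_bilinear.tendsto_zero_bounded_left[OF bounded_bilinear_matrix_vector_mult _
          zz_tendsto_zero[OF i]])
  from tendsto_scaleR[OF tendsto_const this, of \<mu>] show ?thesis by simp
qed

text \<open>The error equation has right-hand side \<open>h t + g t\<close>: \<open>h\<close> is the
  wanted quantity, Lipschitz in time, and \<open>g\<close> vanishes because \<open>zz\<close> and
  the mismatch of \<open>phi\<close> do. As the error itself converges, the Barbalat lemma isolates
  \<open>h\<close>.\<close>

lemma phi_parameter_error_tendsto_zero:
  assumes i: "i \<in> {1..N}"
  shows "((\<lambda>t. phi (vh i t) *v (wh i t - \<omega>)) \<longlongrightarrow> 0) at_top"
proof -
  define h where "h t = phi (vh i t) *v (wh i t - \<omega>)" for t
  define g where "g t = (kh i t * \<rho> (zz i t)) *\<^sub>R zz i t + (phi (vh i t) - phi (v t)) *v \<omega>" for t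
  have D: "((\<lambda>t. vh i t - v t) has_vector_derivative h t + g t) (at t within {0..})" if "t \<ge> 0" for t
  proof -
    have "h t + g t = phi (vh i t) *v wh i t + (kh i t * \<rho> (zz i t)) *\<^sub>R zz i t - phi (v t) *v \<omega>"
      by (simp add: h_def g_def matrix_vector_mult_diff_distrib matrix_vector_mult_diff_rdistrib)
    then show ?thesis
      using has_vector_derivative_diff[OF observer_derivs(1)[OF that i] v_deriv[OF that]] by simp
  qed
  have "blip {0..} (\<lambda>s t d. d = \<bar>s - t\<bar>) (\<lambda>t. kh i t * \<rho> (zz i t))"
    by (intro bounded_bilinear.blip[OF bounded_bilinear_mult] blip_vh_wh_kh(3) i
        blip_smooth[OF _ \<rho>] blip_zz)
  then obtain B where "\<forall>\<^sub>F t in at_top. norm (kh i t * \<rho> (zz i t)) \<le> B"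
    by (rule blip_eventually_bounded)
  then have 1: "((\<lambda>t. (kh i t * \<rho> (zz i t)) *\<^sub>R zz i t) \<longlongrightarrow> 0) at_top"
    by (rule bounded_bilinear.tendsto_zero_bounded_left[OF bounded_bilinear_scaleR _ zz_tendsto_zero[OF i]])
  have 2: "((\<lambda>t. (phi (vh i t) - phi (v t)) *v \<omega>) \<longlongrightarrow> 0) at_top"
    using bounded_bilinear.tendsto[OF bounded_bilinear_matrix_vector_mult phi_error_tendsto_zero[OF i] tendsto_const[of \<omega>]]
    by simp
  have g: "(g \<longlongrightarrow> 0) at_top" unfolding g_def using tendsto_add[OF 1 2] by simp
  have "blip {0..} (\<lambda>s t d. d = \<bar>s - t\<bar>) h"
    unfolding h_def
    by (intro bounded_bilinear.blip[OF bounded_bilinear_matrix_vector_mult] blip_smooth[OF _ phi]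
        blip_diff blip_const blip_vh_wh_kh i)
  then obtain L where L: "\<And>s t. s \<in> {0..} \<Longrightarrow> t \<in> {0..} \<Longrightarrow> norm (h s - h t) \<le> L * \<bar>s - t\<bar>"
    unfolding blip_def by (metis abs_ge_zero)
  have "(h \<longlongrightarrow> 0) at_top"
    by (rule tendsto_zero_of_lipschitz_derivative[OF D error_tendsto_zero[OF i] g, of L]) (use L in auto)
  then show ?thesis by (simp add: h_def[abs_def])
qed

text \<open>Excitation is assumed along the leader, so \<open>phi (vh i t)\<close> is first
  exchanged for \<open>phi (v t)\<close>; the difference tends to 0 and meets the bounded factor
  \<open>wh i t - \<omega>\<close>.\<close>

lemma parameter_error_tendsto_zero:
  assumes PE: "persistently_exciting (\<lambda>t. transpose (phi (v t)))" and i: "i \<in> {1..N}"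
  shows "((\<lambda>t. wh i t - \<omega>) \<longlongrightarrow> 0) at_top"
proof -
  have "blip {0..} (\<lambda>s t d. d = \<bar>s - t\<bar>) (\<lambda>t. phi (v t))"
    by (intro blip_smooth[OF _ phi] blip_vh_wh_kh(4)[OF i])
  then obtain B where B: "\<And>t. t \<in> {0..} \<Longrightarrow> norm (phi (v t)) \<le> B" by (rule blip_bounded) blast
  have "blip {0..} (\<lambda>s t d. d = \<bar>s - t\<bar>) (\<lambda>t. wh i t - \<omega>)"
    by (intro blip_diff blip_const blip_vh_wh_kh i)
  then obtain B' where B': "\<forall>\<^sub>F t in at_top. norm (wh i t - \<omega>) \<le> B'" by (rule blip_eventually_bounded)
  have "((\<lambda>t. (phi (vh i t) - phi (v t)) *v (wh i t - \<omega>)) \<longlongrightarrow> 0) at_top"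
    by (rule bounded_bilinear.tendsto_zero_bounded_left[OF bounded_bilinear.flip[OF bounded_bilinear_matrix_vector_mult]
          B' phi_error_tendsto_zero[OF i]])
  from tendsto_diff[OF phi_parameter_error_tendsto_zero[OF i] this]
  have Fw: "((\<lambda>t. phi (v t) *v (wh i t - \<omega>)) \<longlongrightarrow> 0) at_top"
    by (simp add: matrix_vector_mult_diff_rdistrib)
  have w': "((\<lambda>t. wh i t - \<omega>) has_vector_derivative \<mu> *\<^sub>R (transpose (phi (vh i t)) *v zz i t)) (at t within {0..})"
    if "t \<ge> 0" for t
    using has_vector_derivative_diff[OF observer_derivs(2)[OF that i] has_vector_derivative_const] by simp
  show ?thesis
  proof (rule persistently_exciting_imp_tendsto_zero[OF PE _ _ w' parameter_derivative_tendsto_zero[OF i] Fw])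
    show "continuous_on {0..} (\<lambda>t. phi (v t))"
      by (rule continuous_on_compose2[OF smooth_fun_continuous_on[OF phi, of UNIV] v_cont]) auto
    show "norm (phi (v t)) \<le> B" if "t \<ge> 0" for t using B that by auto
  qed
qed

text \<open>Solutions have derivatives within the half-line, while \<open>vector_derivative\<close>
  here uses full neighbourhoods; the two agree for t > 0, enough for a limit at infinity.\<close>

lemma vector_derivative_parameter_error_tendsto_zero:
  assumes i: "i \<in> {1..N}"
  shows "((\<lambda>t. vector_derivative (\<lambda>s. wh i s - \<omega>) (at t)) \<longlongrightarrow> 0) at_top"
proof (rule Lim_transform_eventually[OF parameter_derivative_tendsto_zero[OF i]])
  show "\<forall>\<^sub>F t in at_top. \<mu> *\<^sub>R (transpose (phi (vh i t)) *v zz i t) = vector_derivative (\<lambda>s. wh i s - \<omega>) (at t)"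
    using eventually_gt_at_top[of 0]
  proof eventually_elim
    case (elim t)
    have "((\<lambda>t. wh i t - \<omega>) has_vector_derivative \<mu> *\<^sub>R (transpose (phi (vh i t)) *v zz i t)) (at t within {0..})"
      using has_vector_derivative_diff[OF observer_derivs(2)[OF _ i] has_vector_derivative_const, of t] elim by simp
    moreover have "at t within {0..} = at t" using elim by (intro at_within_interior) auto
    ultimately show ?case by (simp add: vector_derivative_at)
  qed
qed

end

end

theorem theorem1:
  fixes phi :: "real^'m \<Rightarrow> real^'l^'m"
    and \<omega> :: "real^'l"
    and N :: nat
    and Eg :: "(nat \<times> nat) set"
    and V0 :: "(real^'m) set"
  assumes phi_smooth: "smooth_fun phi"
    and standing: "\<forall>W0. compact W0 \<and> 0 \<in> W0 \<longrightarrow>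
          (\<exists>W. compact W \<and> (\<forall>v. leader_solution phi \<omega> v \<and> v 0 \<in> W0 \<longrightarrow> (\<forall>t\<ge>0. v t \<in> W)))"
    and N_pos: "N \<ge> 1"
    and edges: "Eg \<subseteq> {1..N+1} \<times> {1..N}"
    and spanning_tree: "\<forall>i\<in>{1..N}. (N + 1, i) \<in> Eg\<^sup>+"
    and undirected: "\<forall>i\<in>{1..N}. \<forall>j\<in>{1..N}. (i, j) \<in> Eg \<longleftrightarrow> (j, i) \<in> Eg"
    and V0: "compact V0" "0 \<in> V0"
  shows "\<exists>\<rho> :: nat \<Rightarrow> real^'m \<Rightarrow> real.
     (\<forall>i\<in>{1..N}. smooth_fun (\<rho> i) \<and> (\<forall>x. \<rho> i x \<ge> 1)) \<and>
     (\<forall>\<mu>>0. \<forall>v. leader_solution phi \<omega> v \<and> v 0 \<in> V0 \<longrightarrow>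
       (\<forall>v0 :: nat \<Rightarrow> real^'m. \<forall>w0 :: nat \<Rightarrow> real^'l. \<forall>k0 :: nat \<Rightarrow> real.
         (\<forall>i\<in>{1..N}. v0 i \<in> V0) \<longrightarrow>
         (\<exists>vh wh kh. observer_solution phi N Eg \<mu> \<rho> v vh wh kh \<and>
             (\<forall>i\<in>{1..N}. vh i 0 = v0 i \<and> wh i 0 = w0 i \<and> kh i 0 = k0 i)) \<and>
         (\<forall>vh wh kh. observer_solution phi N Eg \<mu> \<rho> v vh wh kh \<and>
             (\<forall>i\<in>{1..N}. vh i 0 = v0 i \<and> wh i 0 = w0 i \<and> kh i 0 = k0 i) \<longrightarrow>
           (\<forall>i\<in>{1..N}.
              bounded (vh i ` {0..}) \<and> bounded (wh i ` {0..}) \<and> bounded (kh i ` {0..}) \<and>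
              ((\<lambda>t. vh i t - v t) \<longlongrightarrow> 0) at_top \<and>
              ((\<lambda>t. vector_derivative (\<lambda>s. wh i s - \<omega>) (at t)) \<longlongrightarrow> 0) at_top \<and>
              ((\<lambda>t. phi (vh i t) *v (wh i t - \<omega>)) \<longlongrightarrow> 0) at_top) \<and>
           (persistently_exciting (\<lambda>t. transpose (phi (v t))) \<longrightarrow>
              (\<forall>i\<in>{1..N}. ((\<lambda>t. wh i t - \<omega>) \<longlongrightarrow> 0) at_top)))))"
proof -
  interpret observer_graph N Eg
    using N_pos edges spanning_tree undirected by unfold_locales
  \<comment> \<open>The standing assumption is applied to \<open>V0\<close> itself, giving one
    leader bound for all initial values in it; \<rho> and \<kappa> are then fixed before \<mu> and
    any trajectory.\<close>
  obtain W where W: "compact W" "\<And>v t. leader_solution phi \<omega> v \<Longrightarrow> v 0 \<in> V0 \<Longrightarrow> t \<ge> 0 \<Longrightarrow> v t \<in> W"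
    using standing V0 by meson
  obtain Rv where Rv: "\<And>x. x \<in> W \<Longrightarrow> norm x \<le> Rv"
    using compact_imp_bounded[OF W(1)] unfolding bounded_iff by blast
  obtain \<rho> :: "real^'m \<Rightarrow> real" and \<kappa> where \<rho>: "smooth_fun \<rho>" "\<And>x. \<rho> x \<ge> 1"
    and gain: "\<And>(vh :: nat \<Rightarrow> real^'m) u. norm u \<le> Rv \<Longrightarrow>
      (\<Sum>i\<in>{1..N}. - (lap (\<lambda>i. vh i - u) i \<bullet> (phi (vh i) *v \<omega> - phi u *v \<omega>))
        - \<kappa> * (\<rho> (lap (\<lambda>i. vh i - u) i) * (lap (\<lambda>i. vh i - u) i \<bullet> lap (\<lambda>i. vh i - u) i))) \<le> 0"
    using ex_gain[OF phi_smooth, of Rv \<omega>] by blast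
  have gained: "gained_observer N Eg phi \<omega> \<rho> \<kappa> \<mu> Rv v"
    if "\<mu> > 0" and v: "leader_solution phi \<omega> v" "v 0 \<in> V0" for \<mu> v
    using phi_smooth \<rho> gain that W(2)[OF v] Rv by unfold_locales auto
  have ex: "\<exists>vh wh kh. observer_solution phi N Eg \<mu> (\<lambda>_. \<rho>) v vh wh kh \<and>
      (\<forall>i\<in>{1..N}. vh i 0 = v0 i \<and> wh i 0 = w0 i \<and> kh i 0 = k0 i)"
    if "\<mu> > 0" "leader_solution phi \<omega> v" "v 0 \<in> V0"
    for \<mu> v v0 and w0 :: "nat \<Rightarrow> real^'l" and k0 :: "nat \<Rightarrow> real"
    using gained_observer.ex_observer_solution[OF gained[OF that], of v0 w0 k0]
    unfolding observer_solution_iff_observer_at by metis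
  \<comment> \<open>Boundedness and limits are shown for every solution, not only for the one
    provided by \<open>ex\<close>.\<close>
  have conv: "(\<forall>i\<in>{1..N}.
        bounded (vh i ` {0..}) \<and> bounded (wh i ` {0..}) \<and> bounded (kh i ` {0..}) \<and>
        ((\<lambda>t. vh i t - v t) \<longlongrightarrow> 0) at_top \<and>
        ((\<lambda>t. vector_derivative (\<lambda>s. wh i s - \<omega>) (at t)) \<longlongrightarrow> 0) at_top \<and>
        ((\<lambda>t. phi (vh i t) *v (wh i t - \<omega>)) \<longlongrightarrow> 0) at_top) \<and>
      (persistently_exciting (\<lambda>t. transpose (phi (v t))) \<longrightarrow>
        (\<forall>i\<in>{1..N}. ((\<lambda>t. wh i t - \<omega>) \<longlongrightarrow> 0) at_top))"
    if "\<mu> > 0" "leader_solution phi \<omega> v" "v 0 \<in> V0"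
      and sol: "observer_solution phi N Eg \<mu> (\<lambda>_. \<rho>) v vh wh kh" for \<mu> v vh wh kh
  proof -
    interpret gained_observer N Eg phi \<omega> \<rho> \<kappa> \<mu> Rv v using gained that by blast
    have obs: "observer_at phi N Eg \<mu> \<rho> v vh wh kh t" if "t \<ge> 0" for t
      using that sol unfolding observer_solution_iff_observer_at by blast
    obtain R where R: "\<And>i t. i \<in> {1..N} \<Longrightarrow> t \<ge> 0 \<Longrightarrow>
        norm (vh i t) \<le> R \<and> norm (wh i t) \<le> R \<and> norm (kh i t) \<le> R"
      using observer_solution_bounded[OF obs] by blast
    have "bounded (vh i ` {0..})" "bounded (wh i ` {0..})" "bounded (kh i ` {0..})"
      if "i \<in> {1..N}" for i
      using R[OF that] unfolding bounded_iff by auto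
    then show ?thesis
      using error_tendsto_zero[OF obs] vector_derivative_parameter_error_tendsto_zero[OF obs]
        phi_parameter_error_tendsto_zero[OF obs] parameter_error_tendsto_zero[OF obs]
      by blast
  qed
  show ?thesis
  proof (rule exI[of _ "\<lambda>_. \<rho>"], intro conjI[OF _ allI] impI allI)
    show "\<forall>i\<in>{1..N}. smooth_fun \<rho> \<and> (\<forall>x. 1 \<le> \<rho> x)" using \<rho> by blast
  qed (use ex in blast, use conv in blast)
qed

end
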